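(* Let $d\geq 3$ and let $(F_n)_{n\in\mathbb{N}}$ be ballistic aggregation in $\mathbb{Z}^d$. Then almost surely the lower fractal dimension satisfies $$\underline{\delta}_f=\liminf_{n\to\infty}\frac{\log(\# F_n)}{\log(\mathrm{rad}(F_n))}\geq 2.$$
   Context: Here $\mathbb{N}=\{1,2,\ldots\}$ and $\|\cdot\|$ is the Euclidean norm. Two points $x,y\in\mathbb{Z}^d$ are neighbours if $\|x-y\|=1$. For a finite $A\subset\mathbb{Z}^d$, the outer boundary is $\partial A=\{y\in\mathbb{Z}^d\setminus A:\ y \text{ has a neighbour in } A\}$, and $\mathrm{rad}(A)=\max_{x\in A}\|x\|$. Incremental aggregation: let $\mathcal{M}=(\mu_A)$ be a family of probability measures indexed by the nonempty finite sets $A\subset\mathbb{Z}^d$, with $\mu_A$ a probability measure on $A$. A sequence $(F_n)_{n\in\mathbb{N}}$ of random finite subsets of $\mathbb{Z}^d$ on a probability space is called incremental aggregation with distribution family $\mathcal{M}$ if $F_1=\{y_1\}$ with $y_1=0$ and, for each $n\in\mathbb{N}$, $F_{n+1}=F_n\cup\{y_{n+1}\}$, where $y_{n+1}$ is a random point of $\mathbb{Z}^d$ whose conditional distribution given $F_1,\ldots,F_n$ depends only on $F_n$ and equals $\mu_{\partial F_n}$, i.e. $\mathbb{P}(y_{n+1}=y\mid F_n=A)=\mu_{\partial A}(y)$. In particular $(F_n)$ is a Markov chain. Ballistic measure: let $A(d,1)$ be the space of (affine) lines in $\mathbb{R}^d$ with its usual Borel $\sigma$-algebra; for compact $K\subset\mathbb{R}^d$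 let $[K]=\{L\in A(d,1): L\cap K\neq\emptyset\}$. Let $\mu_1$ be the unique Radon measure on $A(d,1)$ invariant under Euclidean motions with $\mu_1([B_d])=\kappa_{d-1}$, where $B_d$ is the closed unit ball of $\mathbb{R}^d$ and $\kappa_{d-1}$ is the volume of the unit ball in $\mathbb{R}^{d-1}$. For compact $K$ with $\mu_1([K])>0$ define the probability measure $\mathbb{P}^K(\cdot)=\mu_1(\cdot\cap[K])/\mu_1([K])$ on $A(d,1)$. For $z\in\mathbb{Z}^d$ let $C_z=z+[-\tfrac12,\tfrac12]^d$ and for finite $A\subset\mathbb{Z}^d$ let $\square A=\bigcup_{z\in A}C_z$. For each line $L$ fix a direction $v_L\in\mathbb{S}^{d-1}$ of $L$ (measurably in $L$). For a nonempty finite $A\subset\mathbb{Z}^d$ let $L^A=\{z\in A: C_z\cap L\neq\emptyset\}$; traversing $L$ in direction $v_L$ orders $L^A$ according to the order in which the boxes $C_z$ are visited (this is well defined for $\mu_1$-almost every $L$; ties for the exceptional lines are broken lexicographically), and $\min(L^A)$, $\max(L^A)$ denote the first and last point of $L^A$ in this order. Set $b_A(z,L)=1$ if $L^A=\{z\}$; $b_A(z,L)=\tfrac12$ if $\#(L^A)>1$ and $z\in\{\min(L^A),\max(L^A)\}$; and $b_A(z,L)=0$ otherwise. The ballistic measure on $A$ is $b_A(z)=\int_{A(d,1)}b_A(z,L)\,\mathbb{P}^{\square A}(dL)$, $z\in\mathbb{Z}^d$; it is a probability measure concentrated on $A$. Ballistic aggregation in $\mathbb{Z}^d$ is incremental aggregation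 with distribution family $(b_A)$. *)

theory Defs
  imports "HOL-Probability.Probability"
begin

text \<open>
  The dimension is \<open>d = CARD('d)\<close>; points of \<open>\<int>\<^sup>d\<close> have type \<open>int ^ 'd\<close>.  A linear order
  on the index type \<open>'d\<close> is only needed to speak of the lexicographic order on \<open>\<int>\<^sup>d\<close>.
\<close>

section \<open>Finite subsets of the integer lattice\<close>

definition real_point :: "int ^ 'd \<Rightarrow> real ^ 'd" where
  "real_point z = (\<chi> i. real_of_int (z $ i))"

definition neighbours :: "int ^ 'd::finite \<Rightarrow> int ^ 'd \<Rightarrow> bool" where
  "neighbours x y \<longleftrightarrow> norm (real_point x - real_point y) = 1"

definition outer_boundary :: "(int ^ 'd::finite) set \<Rightarrow> (int ^ 'd) set" where
  "outer_boundary A = {y. y \<notin> A \<and> (\<exists>x\<in>A. neighbours y x)}"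

definition rad :: "(int ^ 'd::finite) set \<Rightarrow> real" where
  "rad A = Max ((\<lambda>x. norm (real_point x)) ` A)"

text \<open>
  The quotient is meaningless (division by zero) as long as \<open>rad (F n) \<le> 1\<close>.  For an
  aggregation, \<open>F n\<close> has \<open>n\<close> points almost surely, so this concerns finitely many \<open>n\<close>
  only and does not affect the limit inferior.
\<close>

definition lower_fractal_dimension :: "(nat \<Rightarrow> (int ^ 'd::finite) set) \<Rightarrow> ereal" where
  "lower_fractal_dimension F =
     liminf (\<lambda>n. ereal (ln (real (card (F n))) / ln (rad (F n))))"


section \<open>Incremental aggregation\<close>

text \<open>
  \<open>\<nu> A z\<close> is the mass that the distribution \<open>\<nu> A\<close> on the finite set \<open>A\<close> gives to \<open>z\<close>.
  All random variables are discrete, so the conditional law of \<open>y (n + 1)\<close> given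
  \<open>F 1, \<dots>, F n\<close> is described by elementary conditional probabilities, given any history
  of positive probability.  These are probabilities, so the last clause by itself forces
  \<open>\<nu> (outer_boundary A)\<close> to be a probability mass function for every value \<open>A\<close> that the
  process attains with positive probability.  Indices start at 1; \<open>F 0\<close> and \<open>y 0\<close> play
  no role.
\<close>

definition incremental_aggregation ::
  "((int ^ 'd::finite) set \<Rightarrow> int ^ 'd \<Rightarrow> real) \<Rightarrow> 'w measure \<Rightarrow>
     (nat \<Rightarrow> 'w \<Rightarrow> (int ^ 'd) set) \<Rightarrow> bool" where
  "incremental_aggregation \<nu> M F \<longleftrightarrow>
     prob_space M \<and>
     (\<forall>n\<ge>1. F n \<in> measurable M (count_space {A. finite A})) \<and>
     (\<exists>y :: nat \<Rightarrow> 'w \<Rightarrow> int ^ 'd.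
        (\<forall>n\<ge>1. y n \<in> measurable M (count_space UNIV)) \<and>
        (\<forall>\<omega>\<in>space M. y 1 \<omega> = 0 \<and> F 1 \<omega> = {y 1 \<omega>}) \<and>
        (\<forall>n\<ge>1. \<forall>\<omega>\<in>space M. F (n + 1) \<omega> = F n \<omega> \<union> {y (n + 1) \<omega>}) \<and>
        (\<forall>n\<ge>1. \<forall>A :: nat \<Rightarrow> (int ^ 'd) set. \<forall>z.
           \<P>(\<omega> in M. \<forall>k\<in>{1..n}. F k \<omega> = A k) > 0 \<longrightarrow>
           \<P>(\<omega> in M. y (n + 1) \<omega> = z \<bar> \<forall>k\<in>{1..n}. F k \<omega> = A k)
             = \<nu> (outer_boundary (A n)) z))"


section \<open>The space of affine lines\<close>

definition line_through :: "(real ^ 'd) \<times> (real ^ 'd) \<Rightarrow> (real ^ 'd) set" where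
  "line_through = (\<lambda>(a, u). range (\<lambda>t. a + t *\<^sub>R u))"

definition affine_lines :: "(real ^ 'd::finite) set set" where
  "affine_lines = line_through ` (UNIV \<times> sphere 0 1)"

text \<open>
  The usual topology on the space of lines is the quotient topology of the
  parametrization by a point and a unit direction.
\<close>

definition line_topology :: "(real ^ 'd::finite) set topology" where
  "line_topology = topology (\<lambda>U. U \<subseteq> affine_lines \<and>
     openin (top_of_set (UNIV \<times> sphere 0 1)) {p \<in> UNIV \<times> sphere 0 1. line_through p \<in> U})"

lemma openin_line_topology:
  "openin line_topology (U :: (real ^ 'd::finite) set set) \<longleftrightarrow> U \<subseteq> affine_lines \<and>
     openin (top_of_set (UNIV \<times> sphere 0 1)) {p \<in> UNIV \<times> sphere 0 1. line_through p \<in> U}"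
proof -
  let ?S = "UNIV \<times> sphere 0 1 :: ((real ^ 'd) \<times> (real ^ 'd)) set"
  let ?P = "\<lambda>U. {p \<in> ?S. line_through p \<in> U}"
  have "istopology (\<lambda>U. U \<subseteq> affine_lines \<and> openin (top_of_set ?S) (?P U))"
    unfolding istopology_def
  proof (intro conjI allI impI)
    fix U V :: "(real ^ 'd) set set"
    assume U: "U \<subseteq> affine_lines \<and> openin (top_of_set ?S) (?P U)"
      and V: "V \<subseteq> affine_lines \<and> openin (top_of_set ?S) (?P V)"
    show "U \<inter> V \<subseteq> affine_lines" using U by blast
    have "?P (U \<inter> V) = ?P U \<inter> ?P V" by blast
    then show "openin (top_of_set ?S) (?P (U \<inter> V))"
      using U V by (simp only: openin_Int)
  next
    fix \<K> :: "(real ^ 'd) set set set"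
    assume K: "\<forall>K\<in>\<K>. K \<subseteq> affine_lines \<and> openin (top_of_set ?S) (?P K)"
    show "\<Union>\<K> \<subseteq> affine_lines" using K by blast
    have "?P (\<Union>\<K>) = \<Union>(?P ` \<K>)" by blast
    moreover have "openin (top_of_set ?S) (\<Union>(?P ` \<K>))"
      using K by (intro openin_Union) blast
    ultimately show "openin (top_of_set ?S) (?P (\<Union>\<K>))" by (simp only:)
  qed
  then show ?thesis
    unfolding line_topology_def by (simp add: topology_inverse')
qed

lemma topspace_line_topology: "topspace line_topology = (affine_lines :: (real ^ 'd::finite) set set)"
proof (rule antisym)
  show "topspace line_topology \<subseteq> (affine_lines :: (real ^ 'd) set set)"
    using openin_line_topology[of "topspace line_topology"] by blast
next
  let ?S = "UNIV \<times> sphere 0 1 :: ((real ^ 'd) \<times> (real ^ 'd)) set"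
  have eq: "{p \<in> ?S. line_through p \<in> affine_lines} = ?S"
    unfolding affine_lines_def by blast
  have "openin line_topology (affine_lines :: (real ^ 'd) set set)"
    unfolding openin_line_topology eq by (rule conjI[OF order_refl openin_subtopology_self])
  then show "(affine_lines :: (real ^ 'd) set set) \<subseteq> topspace line_topology"
    by (rule openin_subset)
qed

lemma quotient_map_line_through:
  "quotient_map (top_of_set (UNIV \<times> sphere 0 1)) line_topology
     (line_through :: (real ^ 'd::finite) \<times> (real ^ 'd) \<Rightarrow> _)"
  unfolding quotient_map_def topspace_line_topology topspace_euclidean_subtopology
    openin_line_topology
  by (intro conjI allI impI) (simp_all only: affine_lines_def simp_thms)

definition line_borel :: "(real ^ 'd::finite) set measure" where
  "line_borel = sigma affine_lines {U. openin line_topology U}"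

definition hitting_lines :: "(real ^ 'd::finite) set \<Rightarrow> (real ^ 'd) set set" where
  "hitting_lines K = {L \<in> affine_lines. L \<inter> K \<noteq> {}}"

definition euclidean_motion :: "(real ^ 'd::finite \<Rightarrow> real ^ 'd) \<Rightarrow> bool" where
  "euclidean_motion g \<longleftrightarrow>
     (\<exists>a f. orthogonal_transformation f \<and> det (matrix f) = 1 \<and> g = (\<lambda>x. a + f x))"

text \<open>
  The properties that characterize the motion invariant measure \<open>\<mu>\<^sub>1\<close> uniquely.  The
  space of lines is locally compact and second countable, so that a Borel measure on it
  is Radon iff it is finite on compact sets.  Motions are taken to be orientation
  preserving; the measure determined in this way is also invariant under reflections.
\<close>

definition invariant_line_measure :: "(real ^ 'd::finite) set measure \<Rightarrow> bool" where
  "invariant_line_measure \<mu> \<longleftrightarrow>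
     sets \<mu> = sets line_borel \<and>
     (\<forall>\<C>. compactin line_topology \<C> \<longrightarrow> \<C> \<in> sets \<mu> \<longrightarrow> emeasure \<mu> \<C> < \<infinity>) \<and>
     (\<forall>g. euclidean_motion g \<longrightarrow> (\<forall>E\<in>sets \<mu>. emeasure \<mu> ((`) g ` E) = emeasure \<mu> E)) \<and>
     emeasure \<mu> (hitting_lines (cball 0 1)) = ennreal (unit_ball_vol (real CARD('d) - 1))"

definition line_direction :: "((real ^ 'd::finite) set \<Rightarrow> real ^ 'd) \<Rightarrow> bool" where
  "line_direction v \<longleftrightarrow>
     v \<in> borel_measurable line_borel \<and>
     (\<forall>L\<in>affine_lines. norm (v L) = 1 \<and> (\<exists>a. L = line_through (a, v L)))"


section \<open>Ballistic measure\<close>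

definition unit_box :: "int ^ 'd::finite \<Rightarrow> (real ^ 'd) set" where
  "unit_box z = {real_point z + x | x. \<forall>i. x $ i \<in> {- 1/2 .. 1/2}}"

definition boxes :: "(int ^ 'd::finite) set \<Rightarrow> (real ^ 'd) set" where
  "boxes A = (\<Union>z\<in>A. unit_box z)"

definition points_on_line :: "(int ^ 'd::finite) set \<Rightarrow> (real ^ 'd) set \<Rightarrow> (int ^ 'd) set" where
  "points_on_line A L = {z \<in> A. unit_box z \<inter> L \<noteq> {}}"

text \<open>
  Along \<open>L\<close>, \<open>x \<bullet> v L\<close> increases at unit speed when \<open>L\<close> is traversed in direction \<open>v L\<close>.
\<close>

definition entry_time ::
  "((real ^ 'd::finite) set \<Rightarrow> real ^ 'd) \<Rightarrow> (real ^ 'd) set \<Rightarrow> int ^ 'd \<Rightarrow> real" where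
  "entry_time v L z = Inf ((\<lambda>x. x \<bullet> v L) ` (unit_box z \<inter> L))"

definition lex_before :: "(int, 'd::{finite,linorder}) vec \<Rightarrow> (int, 'd) vec \<Rightarrow> bool" where
  "lex_before z w \<longleftrightarrow> (\<exists>i. z $ i < w $ i \<and> (\<forall>j<i. z $ j = w $ j))"

definition visited_before ::
  "((real, 'd::{finite,linorder}) vec set \<Rightarrow> (real, 'd) vec) \<Rightarrow> (real, 'd) vec set \<Rightarrow>
     (int, 'd) vec \<Rightarrow> (int, 'd) vec \<Rightarrow> bool" where
  "visited_before v L z w \<longleftrightarrow>
     entry_time v L z < entry_time v L w \<or>
     entry_time v L z = entry_time v L w \<and> lex_before z w"

definition is_first_point ::
  "((real, 'd::{finite,linorder}) vec set \<Rightarrow> (real, 'd) vec) \<Rightarrow> (real, 'd) vec set \<Rightarrow>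
     (int, 'd) vec set \<Rightarrow> (int, 'd) vec \<Rightarrow> bool" where
  "is_first_point v L B z \<longleftrightarrow> z \<in> B \<and> (\<forall>w\<in>B. w \<noteq> z \<longrightarrow> visited_before v L z w)"

definition is_last_point ::
  "((real, 'd::{finite,linorder}) vec set \<Rightarrow> (real, 'd) vec) \<Rightarrow> (real, 'd) vec set \<Rightarrow>
     (int, 'd) vec set \<Rightarrow> (int, 'd) vec \<Rightarrow> bool" where
  "is_last_point v L B z \<longleftrightarrow> z \<in> B \<and> (\<forall>w\<in>B. w \<noteq> z \<longrightarrow> visited_before v L w z)"

definition ballistic_weight ::
  "((real, 'd::{finite,linorder}) vec set \<Rightarrow> (real, 'd) vec) \<Rightarrow> (int, 'd) vec set \<Rightarrow>
     (int, 'd) vec \<Rightarrow> (real, 'd) vec set \<Rightarrow> real" where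
  "ballistic_weight v A z L =
     (let B = points_on_line A L in
      if B = {z} then 1
      else if card B > 1 \<and> (is_first_point v L B z \<or> is_last_point v L B z) then 1/2
      else 0)"

text \<open>
  \<open>uniform_measure \<mu> [K]\<close> is the library's \<open>\<mu>(\<cdot> \<inter> [K]) / \<mu>([K])\<close>.
\<close>

definition ballistic_measure ::
  "(real, 'd::{finite,linorder}) vec set measure \<Rightarrow> ((real, 'd) vec set \<Rightarrow> (real, 'd) vec) \<Rightarrow>
     (int, 'd) vec set \<Rightarrow> (int, 'd) vec \<Rightarrow> real" where
  "ballistic_measure \<mu> v A z =
     (LINT L | uniform_measure \<mu> (hitting_lines (boxes A)). ballistic_weight v A z L)"

definition ballistic_aggregation ::
  "(real, 'd::{finite,linorder}) vec set measure \<Rightarrow> ((real, 'd) vec set \<Rightarrow> (real, 'd) vec) \<Rightarrow>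
     'w measure \<Rightarrow> (nat \<Rightarrow> 'w \<Rightarrow> (int, 'd) vec set) \<Rightarrow> bool" where
  "ballistic_aggregation \<mu> v M F \<longleftrightarrow> incremental_aggregation (ballistic_measure \<mu> v) M F"

end

theory Submission
  imports Defs "HOL-Real_Asymp.Real_Asymp"
begin

text \<open>
  A line meeting \<open>\<box>A\<close> also meets \<open>\<box>\<partial>A\<close>, so every point is added with conditional probability
  at most \<open>\<mu>\<^sub>1[C\<^sub>0] / \<mu>\<^sub>1[\<box>A]\<close>.  The second moment method shows that \<open>\<mu>\<^sub>1[\<box>A] \<ge> c \<surd>#A\<close>: by rotation
  invariance the measure of the lines meeting two given boxes at distance \<open>R\<close> is \<open>O(1/R)\<close>, and a
  line meets only \<open>O(R)\<close> boxes within distance \<open>R\<close> of a given point; use this with \<open>R = \<surd>#A\<close>.  Hence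
  a given point is added in step \<open>n\<close> with probability \<open>O(1/\<surd>n)\<close>, which gives
  \<open>E S\<^bsub>n+1\<^esub> \<le> (1 + O(1/\<surd>n)) E S\<^sub>n\<close> for \<open>S\<^sub>n = \<Sum>x\<in>F\<^sub>n. exp \<parallel>x\<parallel>\<close>, so that \<open>E S\<^sub>n \<le> exp (O(\<surd>n))\<close>.  By
  Markov's inequality and the Borel-Cantelli lemma, almost surely \<open>rad F\<^sub>n = O(\<surd>n)\<close>, whereas
  \<open>F\<^sub>n\<close> has \<open>n\<close> points.
\<close>

section \<open>Lines meeting two balls\<close>

text \<open>Incidence as an equation between continuous functions of \<open>x\<close>,
  \<open>a\<close> and \<open>u\<close>, hence a closed condition on the three jointly.\<close>

lemma mem_line_through_iff:
  fixes a u :: "real ^ 'd::finite"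
  assumes "norm u = 1"
  shows "x \<in> line_through (a, u) \<longleftrightarrow> x - a = ((x - a) \<bullet> u) *\<^sub>R u"
proof
  assume "x \<in> line_through (a, u)"
  then obtain t where "x = a + t *\<^sub>R u" by (auto simp: line_through_def)
  moreover have "u \<bullet> u = 1" using assms by (simp add: dot_square_norm)
  ultimately show "x - a = ((x - a) \<bullet> u) *\<^sub>R u" by simp
next
  assume "x - a = ((x - a) \<bullet> u) *\<^sub>R u"
  then have "x = a + ((x - a) \<bullet> u) *\<^sub>R u" by (simp add: algebra_simps)
  then show "x \<in> line_through (a, u)" unfolding line_through_def by blast
qed

lemma affine_lines_E:
  assumes "L \<in> affine_lines"
  obtains b u where "norm u = 1" "L = line_through (b, u)"
  using assms by (auto simp: affine_lines_def)

lemma space_line_borel: "space line_borel = affine_lines"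
  unfolding line_borel_def by (rule space_measure_of) (auto simp: openin_line_topology)

text \<open>The lines missing \<open>K\<close> form an open set: the set \<open>T\<close> of
  parameters \<open>(a, u)\<close> for which the incidence equation has a solution in
  \<open>K\<close> is the projection of a closed set along the compact factor \<open>K\<close>,
  hence closed, and \<open>line_topology\<close> is the quotient topology of the
  parametrization.\<close>

lemma hitting_lines_in_sets:
  fixes K :: "(real ^ 'd::finite) set"
  assumes "compact K"
  shows "hitting_lines K \<in> sets line_borel"
proof -
  let ?S = "UNIV \<times> sphere 0 1 :: ((real ^ 'd) \<times> (real ^ 'd)) set"
  define T where "T = {p :: (real ^ 'd) \<times> (real ^ 'd). \<exists>k. k \<in> K \<and>
    (k, p) \<in> {q. fst q - fst (snd q) = ((fst q - fst (snd q)) \<bullet> snd (snd q)) *\<^sub>R snd (snd q)}}"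
  have "closed {q :: (real ^ 'd) \<times> ((real ^ 'd) \<times> (real ^ 'd)).
      fst q - fst (snd q) = ((fst q - fst (snd q)) \<bullet> snd (snd q)) *\<^sub>R snd (snd q)}"
    by (intro closed_Collect_eq continuous_intros)
  then have "closed T" unfolding T_def by (rule closed_compact_projection[OF assms])
  moreover have "{p \<in> ?S. line_through p \<in> affine_lines - hitting_lines K} = ?S \<inter> (- T)"
  proof (intro set_eqI)
    fix p :: "(real ^ 'd) \<times> (real ^ 'd)"
    obtain a u where p: "p = (a, u)" by force
    have "line_through p \<in> affine_lines" if "p \<in> ?S" using that by (auto simp: affine_lines_def)
    moreover have "line_through p \<inter> K \<noteq> {} \<longleftrightarrow> p \<in> T" if "p \<in> ?S"
      using mem_line_through_iff[of u _ a] that unfolding p T_def by auto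
    ultimately show "p \<in> {p \<in> ?S. line_through p \<in> affine_lines - hitting_lines K} \<longleftrightarrow> p \<in> ?S \<inter> (- T)"
      unfolding hitting_lines_def by blast
  qed
  ultimately have "openin line_topology (affine_lines - hitting_lines K)"
    unfolding openin_line_topology by (auto intro: openin_open_Int)
  then have "affine_lines - hitting_lines K \<in> sets line_borel"
    unfolding line_borel_def by (intro in_measure_of) (auto simp: openin_line_topology)
  then have "affine_lines - (affine_lines - hitting_lines K) \<in> sets line_borel"
    using sets.compl_sets[of _ line_borel] space_line_borel by metis
  moreover have "affine_lines - (affine_lines - hitting_lines K) = hitting_lines K"
    by (auto simp: hitting_lines_def)
  ultimately show ?thesis by simp
qed

lemma hitting_lines_mono: "K \<subseteq> K' \<Longrightarrow> hitting_lines K \<subseteq> hitting_lines K'"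
  by (auto simp: hitting_lines_def)

lemma hitting_lines_UN: "hitting_lines (\<Union>i\<in>I. K i) = (\<Union>i\<in>I. hitting_lines (K i))"
  by (auto simp: hitting_lines_def)

text \<open>A motion with linear part \<open>f\<close> maps the line through \<open>b\<close> with
  direction \<open>u\<close> to the line through \<open>g b\<close> with direction
  \<open>f u\<close>; as \<open>f\<close> is onto, every line arises in this way. Injectivity of
  \<open>g\<close> carries incidences back.\<close>

lemma image_hitting_lines:
  fixes g :: "real ^ 'd::finite \<Rightarrow> real ^ 'd"
  assumes "euclidean_motion g"
  shows "(`) g ` hitting_lines K = hitting_lines (g ` K)"
proof -
  obtain a f where f: "orthogonal_transformation f" and g: "g = (\<lambda>x. a + f x)"
    using assms unfolding euclidean_motion_def by blast
  have lin: "linear f" using f by (rule orthogonal_transformation_linear)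
  have inj: "inj g" using orthogonal_transformation_inj[OF f] by (auto simp: g inj_def)
  have img: "g ` line_through (b, u) = line_through (g b, f u)" for b u
    by (auto simp: line_through_def g image_image linear_add[OF lin] linear_scale[OF lin] algebra_simps
        intro!: image_eqI)
  have nrm: "norm (f u) = norm u" for u using f by (rule orthogonal_transformation_norm)
  have mem: "g ` L \<in> hitting_lines (g ` K)" if L: "L \<in> hitting_lines K" for L
  proof -
    from L have "L \<in> affine_lines" "L \<inter> K \<noteq> {}" by (auto simp: hitting_lines_def)
    then obtain b u where bu: "norm u = 1" "L = line_through (b, u)" by (elim affine_lines_E)
    have "g ` L = line_through (g b, f u)" using img bu by simp
    moreover have "(g b, f u) \<in> UNIV \<times> sphere 0 1" using nrm bu by simp
    ultimately have "g ` L \<in> affine_lines" unfolding affine_lines_def by blast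
    then show ?thesis using \<open>L \<inter> K \<noteq> {}\<close> unfolding hitting_lines_def by blast
  qed
  have surj: "L \<in> (`) g ` hitting_lines K" if L: "L \<in> hitting_lines (g ` K)" for L
  proof -
    from L have "L \<in> affine_lines" and LK: "L \<inter> g ` K \<noteq> {}" by (auto simp: hitting_lines_def)
    then obtain b u where bu: "norm u = 1" "L = line_through (b, u)" by (elim affine_lines_E)
    have sf: "surj f" using f by (rule orthogonal_transformation_surj)
    obtain u' where u': "f u' = u" using sf by (metis surjD)
    obtain b' where "f b' = b - a" using sf by (metis surjD)
    then have b': "g b' = b" by (simp add: g)
    have eq: "L = g ` line_through (b', u')" using img u' b' bu by simp
    have "(b', u') \<in> UNIV \<times> sphere 0 1" using nrm[of u'] bu u' by simp
    then have "line_through (b', u') \<in> affine_lines" unfolding affine_lines_def by blast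
    moreover have "line_through (b', u') \<inter> K \<noteq> {}" using LK eq inj by (auto simp: inj_eq)
    ultimately show ?thesis using eq by (auto simp: hitting_lines_def)
  qed
  show ?thesis using mem surj by blast
qed

lemma image_Int_hitting_lines:
  fixes g :: "real ^ 'd::finite \<Rightarrow> real ^ 'd"
  assumes "euclidean_motion g"
  shows "(`) g ` (hitting_lines K \<inter> hitting_lines K') = hitting_lines (g ` K) \<inter> hitting_lines (g ` K')"
proof -
  obtain a f where "orthogonal_transformation f" and g: "g = (\<lambda>x. a + f x)"
    using assms unfolding euclidean_motion_def by blast
  then have "inj g" using orthogonal_transformation_inj[of f] by (simp add: g inj_def)
  then have "inj ((`) g)" by (intro injI) (simp add: inj_image_eq_iff)
  then show ?thesis by (simp add: image_Int image_hitting_lines[OF assms])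
qed

lemma euclidean_motion_translation: "euclidean_motion ((+) (a :: real ^ 'd::finite))"
  unfolding euclidean_motion_def
  by (intro exI[of _ a] exI[of _ "\<lambda>x. x"])
     (auto simp: orthogonal_transformation_def linear_id[unfolded id_def] matrix_id_mat_1[unfolded id_def])

lemma euclidean_motion_rotation:
  assumes "orthogonal_transformation f" "det (matrix f) = 1"
  shows "euclidean_motion f"
  unfolding euclidean_motion_def using assms by (intro exI[of _ 0] exI[of _ f]) auto

section \<open>Invariant measure of the lines meeting balls and compact sets\<close>

context
  fixes \<mu> :: "(real ^ 'd::finite) set measure"
  assumes inv: "invariant_line_measure \<mu>"
begin

lemma hitting_lines_measurable: "compact K \<Longrightarrow> hitting_lines K \<in> sets \<mu>"
  using inv hitting_lines_in_sets by (auto simp: invariant_line_measure_def)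

text \<open>Stated for pairs because the two-ball estimate needs it; \<open>K = K'\<close> gives the
  invariance of the measure of a single hitting set.\<close>

lemma emeasure_Int_hitting_lines_motion:
  assumes "euclidean_motion g" "compact K" "compact K'"
  shows "emeasure \<mu> (hitting_lines (g ` K) \<inter> hitting_lines (g ` K')) =
    emeasure \<mu> (hitting_lines K \<inter> hitting_lines K')"
proof -
  have "hitting_lines K \<inter> hitting_lines K' \<in> sets \<mu>"
    using assms by (intro sets.Int hitting_lines_measurable)
  then have "emeasure \<mu> ((`) g ` (hitting_lines K \<inter> hitting_lines K')) =
      emeasure \<mu> (hitting_lines K \<inter> hitting_lines K')"
    using inv assms(1) unfolding invariant_line_measure_def by blast
  then show ?thesis by (simp only: image_Int_hitting_lines[OF assms(1)])
qed

lemma emeasure_hitting_lines_cball_translate: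
  "emeasure \<mu> (hitting_lines (cball x r)) = emeasure \<mu> (hitting_lines (cball 0 r))"
  using emeasure_Int_hitting_lines_motion[OF euclidean_motion_translation[of x], of "cball 0 r" "cball 0 r"]
  by (simp flip: cball_translation)

text \<open>Finitely many translates of the small ball cover the large one, and all translates have
  the same measure. With \<open>s = 1\<close> this gives finiteness for every radius, with
  \<open>r = 1\<close> positivity.\<close>

lemma hitting_lines_cball_le:
  assumes "0 < s"
  shows "\<exists>k. emeasure \<mu> (hitting_lines (cball 0 r)) \<le> of_nat k * emeasure \<mu> (hitting_lines (cball 0 s))"
proof -
  have "cball (0 :: real ^ 'd) r \<subseteq> \<Union> ((\<lambda>x. ball x s) ` UNIV)"
    using assms centre_in_ball by blast
  then obtain C where C: "C \<subseteq> (\<lambda>x. ball x s) ` (UNIV :: (real ^ 'd) set)" "finite C" "cball (0 :: real ^ 'd) r \<subseteq> \<Union> C"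
    by (rule compactE[OF compact_cball]) auto
  obtain X :: "(real ^ 'd) set" where X: "finite X" "C = (\<lambda>x. ball x s) ` X"
    using C(1,2) by (meson finite_subset_image)
  have "\<Union> C \<subseteq> (\<Union>x\<in>X. cball x s)"
    unfolding X(2) using ball_subset_cball by blast
  then have "hitting_lines (cball (0 :: real ^ 'd) r) \<subseteq> hitting_lines (\<Union>x\<in>X. cball x s)"
    using C(3) by (intro hitting_lines_mono) (rule order_trans)
  then have "emeasure \<mu> (hitting_lines (cball 0 r)) \<le> emeasure \<mu> (\<Union>x\<in>X. hitting_lines (cball x s))"
    unfolding hitting_lines_UN using X hitting_lines_measurable by (intro emeasure_mono) auto
  also have "\<dots> \<le> (\<Sum>x\<in>X. emeasure \<mu> (hitting_lines (cball x s)))"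
    using X hitting_lines_measurable by (intro emeasure_subadditive_finite) auto
  also have "\<dots> = (\<Sum>x\<in>X. emeasure \<mu> (hitting_lines (cball 0 s)))"
    by (intro sum.cong refl emeasure_hitting_lines_cball_translate)
  also have "\<dots> = of_nat (card X) * emeasure \<mu> (hitting_lines (cball 0 s))" by simp
  finally show ?thesis by blast
qed

lemma emeasure_hitting_unit_ball:
  "0 < emeasure \<mu> (hitting_lines (cball 0 1))" "emeasure \<mu> (hitting_lines (cball 0 1)) < \<infinity>"
  using inv unit_ball_vol_pos[of "real CARD('d) - 1"] one_le_card_finite[where 'a = 'd]
  by (auto simp: invariant_line_measure_def)

lemma emeasure_hitting_lines_cball_finite: "emeasure \<mu> (hitting_lines (cball x r)) < \<infinity>"
proof -
  obtain k where "emeasure \<mu> (hitting_lines (cball 0 r)) \<le> of_nat k * emeasure \<mu> (hitting_lines (cball 0 1))"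
    using hitting_lines_cball_le[of 1 r] by auto
  also have "\<dots> < \<infinity>" using emeasure_hitting_unit_ball by (auto simp: ennreal_mult_less_top ennreal_of_nat_eq_real_of_nat)
  finally show ?thesis by (simp only: emeasure_hitting_lines_cball_translate[of x])
qed

lemma emeasure_hitting_lines_cball_pos:
  assumes "0 < s" shows "0 < emeasure \<mu> (hitting_lines (cball x s))"
proof -
  obtain k where "emeasure \<mu> (hitting_lines (cball 0 1)) \<le> of_nat k * emeasure \<mu> (hitting_lines (cball 0 s))"
    using hitting_lines_cball_le[OF assms, of 1] by auto
  then have "emeasure \<mu> (hitting_lines (cball 0 s)) \<noteq> 0"
    using emeasure_hitting_unit_ball(1) by (intro notI) simp
  then show ?thesis
    unfolding emeasure_hitting_lines_cball_translate[of x] by (simp only: zero_less_iff_neq_zero not_False_eq_True)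
qed

lemma hitting_lines_fmeasurable:
  assumes "compact K" shows "hitting_lines K \<in> fmeasurable \<mu>"
proof -
  obtain r where "K \<subseteq> cball 0 r"
    using bounded_subset_ballD[OF compact_imp_bounded[OF assms], of 0] ball_subset_cball by blast
  then have "emeasure \<mu> (hitting_lines K) \<le> emeasure \<mu> (hitting_lines (cball 0 r))"
    by (intro emeasure_mono hitting_lines_mono hitting_lines_measurable) auto
  then show ?thesis
    using emeasure_hitting_lines_cball_finite[of 0 r] hitting_lines_measurable[OF assms]
    by (intro fmeasurableI) auto
qed

text \<open>
  About \<open>\<parallel>w\<parallel> / (9 r)\<close> rotated copies of the ball around \<open>w\<close> fit on a quarter circle around the
  origin such that no line meeting \<open>cball 0 r\<close> meets two of them.
\<close>

lemma measure_Int_hitting_balls_le: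
  fixes w :: "real ^ 'd"
  assumes d: "CARD('d) \<ge> 2" and r: "0 < r"
  shows "measure \<mu> (hitting_lines (cball 0 r) \<inter> hitting_lines (cball w r)) * norm w
    \<le> 9 * r * measure \<mu> (hitting_lines (cball 0 r))"
\<comment> \<open>Up to \<open>8 * r\<close> monotonicity suffices; beyond it the disjointness
  argument applies, whose errors add up to \<open>2 * r + 2 * r + 4 * r\<close>.\<close>
proof (cases "norm w \<le> 8 * r")
  case True
  have "measure \<mu> (hitting_lines (cball 0 r) \<inter> hitting_lines (cball w r)) \<le> measure \<mu> (hitting_lines (cball 0 r))"
    using hitting_lines_fmeasurable[of "cball 0 r"] hitting_lines_fmeasurable[of "cball w r"]
    by (intro measure_mono_fmeasurable) auto
  then have "measure \<mu> (hitting_lines (cball 0 r) \<inter> hitting_lines (cball w r)) * norm w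
     \<le> measure \<mu> (hitting_lines (cball 0 r)) * (9 * r)"
    using True r by (intro mult_mono) auto
  then show ?thesis by (simp add: mult_ac)
next
  case False
  define \<rho> where "\<rho> = norm w"
  have \<rho>: "8 * r < \<rho>" using False by (simp add: \<rho>_def)
  have "\<not> (\<forall>i\<in>UNIV. \<forall>j\<in>UNIV. i = (j :: 'd))"
    using d card_le_Suc0_iff_eq[of "UNIV :: 'd set"] by simp
  then obtain i j :: 'd where ij: "i \<noteq> j" by blast
  define e1 :: "real ^ 'd" where "e1 = axis i 1"
  define e2 :: "real ^ 'd" where "e2 = axis j 1"
  have e: "e1 \<bullet> e1 = 1" "e2 \<bullet> e2 = 1" "e1 \<bullet> e2 = 0" "e2 \<bullet> e1 = 0" "norm e1 = 1" using ij
    by (auto simp: e1_def e2_def inner_axis_axis)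
  \<comment> \<open>There will be \<open>m + 1\<close> copies: \<open>m\<close> is the largest
    number for which the first coordinates \<open>9 * r * k\<close>, \<open>k \<le> m\<close>, do
    not exceed \<open>\<rho>\<close>.\<close>
  define m where "m = nat \<lfloor>\<rho> / (9 * r)\<rfloor>"
  have m: "9 * r * real k \<le> \<rho>" if "k \<le> m" for k
  proof -
    have "real k \<le> real m" using that by simp
    also have "\<dots> \<le> \<rho> / (9 * r)" unfolding m_def using r \<rho> by (simp add: of_nat_nat)
    finally show ?thesis using r by (simp add: field_simps)
  qed
  have m': "\<rho> \<le> 9 * r * (real m + 1)"
  proof -
    have "\<rho> / (9 * r) \<le> real m + 1" unfolding m_def using r \<rho> by (simp add: of_nat_nat)
    then show ?thesis using r by (simp add: field_simps)
  qed
  \<comment> \<open>For \<open>k \<le> m\<close>, the point of the circle of radius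
    \<open>\<rho>\<close> in the plane of \<open>e1\<close> and \<open>e2\<close> with first
    coordinate \<open>9 * r * k\<close>. The first coordinates keep distinct points
    \<open>9 * r\<close> apart; as all of them lie in one quadrant, inner products are nonnegative
    and sums have norm at least \<open>\<rho>\<close>.\<close>
  define p where "p k = (9 * r * real k) *\<^sub>R e1 + sqrt (\<rho>\<^sup>2 - (9 * r * real k)\<^sup>2) *\<^sub>R e2" for k
  have sq: "(9 * r * real k)\<^sup>2 \<le> \<rho>\<^sup>2" if "k \<le> m" for k
    using m[OF that] r by (intro power_mono) auto
  have pn: "norm (p k) = \<rho>" if "k \<le> m" for k
  proof -
    have "p k \<bullet> p k = \<rho>\<^sup>2" unfolding p_def using sq[OF that] e
      by (simp add: inner_add_left inner_add_right flip: power2_eq_square)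
    then have "(norm (p k))\<^sup>2 = \<rho>\<^sup>2" by (simp add: power2_norm_eq_inner)
    then show ?thesis by (rule power2_eq_imp_eq) (auto simp: \<rho>_def)
  qed
  have pd: "9 * r \<le> norm (p k - p l)" if "k \<noteq> l" for k l
  proof -
    have "9 * r * 1 \<le> 9 * r * \<bar>real k - real l\<bar>" using that r by (intro mult_left_mono) auto
    also have "\<dots> = \<bar>9 * r * real k - 9 * r * real l\<bar>" using r by (simp add: abs_mult flip: right_diff_distrib)
    also have "\<dots> = \<bar>(p k - p l) \<bullet> e1\<bar>" unfolding p_def using e by (simp add: inner_add_left inner_diff_left)
    also have "\<dots> \<le> norm (p k - p l)" using Cauchy_Schwarz_ineq2[of "p k - p l" e1] e by simp
    finally show ?thesis by simp
  qed
  have ps: "\<rho> \<le> norm (p k + p l)" if kl: "k \<le> m" "l \<le> m" for k l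
  proof -
    have "0 \<le> p k \<bullet> p l" unfolding p_def using e r sq kl
      by (auto simp: inner_add_left inner_add_right)
    moreover have "(norm (p k + p l))\<^sup>2 = (norm (p k))\<^sup>2 + (norm (p l))\<^sup>2 + 2 * (p k \<bullet> p l)"
      by (simp add: power2_norm_eq_inner inner_add_left inner_add_right inner_commute)
    ultimately have "\<rho>\<^sup>2 \<le> (norm (p k + p l))\<^sup>2" using pn kl by simp
    then show ?thesis by (rule power2_le_imp_le) simp
  qed
  define E where "E k = hitting_lines (cball 0 r) \<inter> hitting_lines (cball (p k) r)" for k
  have Em: "E k \<in> fmeasurable \<mu>" for k unfolding E_def by (intro fmeasurable.Int hitting_lines_fmeasurable) auto
  \<comment> \<open>A rotation taking \<open>w\<close> to \<open>p k\<close> fixes the ball around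
    the origin, so all sets \<open>E k\<close> have the same measure.\<close>
  have ME: "measure \<mu> (E k) = measure \<mu> (hitting_lines (cball 0 r) \<inter> hitting_lines (cball w r))" if k: "k \<le> m" for k
  proof -
    obtain f where f: "orthogonal_transformation f" "det (matrix f) = 1" "f w = p k"
      using rotation_exists[OF d, of w "p k"] pn[OF k] \<rho>_def by metis
    have "f ` cball x r = cball (f x) r" for x
      by (rule image_orthogonal_transformation_cball[OF f(1)])
    moreover have "f 0 = 0" using f(1) by (simp add: linear_0 orthogonal_transformation_linear)
    ultimately show ?thesis
      using emeasure_Int_hitting_lines_motion[OF euclidean_motion_rotation[OF f(1,2)], of "cball 0 r" "cball w r"] f(3)
      by (simp add: E_def measure_def)
  qed
  have disj: "E k \<inter> E l = {}" if kl: "k \<le> m" "l \<le> m" "k \<noteq> l" for k l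
  proof (rule ccontr)
    assume "E k \<inter> E l \<noteq> {}"
    then obtain L where L: "L \<in> affine_lines" "L \<inter> cball 0 r \<noteq> {}" "L \<inter> cball (p k) r \<noteq> {}" "L \<inter> cball (p l) r \<noteq> {}"
      by (auto simp: E_def hitting_lines_def)
    obtain b u where bu: "norm u = 1" "L = line_through (b, u)" using L(1) by (elim affine_lines_E)
    obtain \<alpha> where a: "norm (b + \<alpha> *\<^sub>R u) \<le> r" using L(2) bu(2) by (auto simp: line_through_def)
    obtain \<beta> where b: "norm (p k - (b + \<beta> *\<^sub>R u)) \<le> r" using L(3) bu(2) by (auto simp: line_through_def dist_norm)
    obtain \<gamma> where c: "norm (p l - (b + \<gamma> *\<^sub>R u)) \<le> r" using L(4) bu(2) by (auto simp: line_through_def dist_norm)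
    \<comment> \<open>\<open>\<alpha>\<close>, \<open>\<beta>\<close> and \<open>\<gamma>\<close>
      are parameters at which the line passes through the three balls. Counted from the point near
      the origin, \<open>p k\<close> and \<open>p l\<close> are within \<open>2 * r\<close> of
      \<open>s *\<^sub>R u\<close> and \<open>t *\<^sub>R u\<close>.\<close>
    define s where "s = \<beta> - \<alpha>"
    define t where "t = \<gamma> - \<alpha>"
    have "p k - s *\<^sub>R u = (p k - (b + \<beta> *\<^sub>R u)) + (b + \<alpha> *\<^sub>R u)" by (simp add: s_def algebra_simps)
    then have "norm (p k - s *\<^sub>R u) \<le> norm (p k - (b + \<beta> *\<^sub>R u)) + norm (b + \<alpha> *\<^sub>R u)"
      by (simp only: norm_triangle_ineq)
    then have s: "norm (p k - s *\<^sub>R u) \<le> 2 * r" using a b by linarith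
    have "p l - t *\<^sub>R u = (p l - (b + \<gamma> *\<^sub>R u)) + (b + \<alpha> *\<^sub>R u)" by (simp add: t_def algebra_simps)
    then have "norm (p l - t *\<^sub>R u) \<le> norm (p l - (b + \<gamma> *\<^sub>R u)) + norm (b + \<alpha> *\<^sub>R u)"
      by (simp only: norm_triangle_ineq)
    then have t: "norm (p l - t *\<^sub>R u) \<le> 2 * r" using a c by linarith
    have "\<bar>\<rho> - \<bar>s\<bar>\<bar> \<le> 2 * r" using norm_triangle_ineq3[of "p k" "s *\<^sub>R u"] s pn kl(1) bu(1) by simp
    moreover have "\<bar>\<rho> - \<bar>t\<bar>\<bar> \<le> 2 * r" using norm_triangle_ineq3[of "p l" "t *\<^sub>R u"] t pn kl(2) bu(1) by simp
    \<comment> \<open>The absolute values of \<open>s\<close> and \<open>t\<close> are both within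
      \<open>2 * r\<close> of \<open>\<rho>\<close>. Equal signs would make \<open>p k\<close> and
      \<open>p l\<close> closer than \<open>9 * r\<close>; opposite signs would make their sum
      shorter than \<open>\<rho>\<close>.\<close>
    ultimately have "\<bar>s - t\<bar> \<le> 4 * r \<or> \<bar>s + t\<bar> \<le> 4 * r" by linarith
    then show False
    proof
      assume st: "\<bar>s - t\<bar> \<le> 4 * r"
      have "p k - p l = (p k - s *\<^sub>R u) - (p l - t *\<^sub>R u) + (s - t) *\<^sub>R u" by (simp add: algebra_simps)
      then have "norm (p k - p l) \<le> norm (p k - s *\<^sub>R u) + norm (p l - t *\<^sub>R u) + norm ((s - t) *\<^sub>R u)"
        by (simp only:) (intro order_trans[OF norm_triangle_ineq] add_right_mono norm_triangle_ineq4)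
      also have "norm ((s - t) *\<^sub>R u) = \<bar>s - t\<bar>" using bu(1) by simp
      finally show False using pd[OF kl(3)] s t st r by linarith
    next
      assume st: "\<bar>s + t\<bar> \<le> 4 * r"
      have "p k + p l = (p k - s *\<^sub>R u) + (p l - t *\<^sub>R u) + (s + t) *\<^sub>R u" by (simp add: algebra_simps)
      then have "norm (p k + p l) \<le> norm (p k - s *\<^sub>R u) + norm (p l - t *\<^sub>R u) + norm ((s + t) *\<^sub>R u)"
        by (simp only:) (intro order_trans[OF norm_triangle_ineq] add_right_mono norm_triangle_ineq)
      also have "norm ((s + t) *\<^sub>R u) = \<bar>s + t\<bar>" using bu(1) by simp
      finally show False using ps[OF kl(1,2)] s t st \<rho> by linarith
    qed
  qed
  \<comment> \<open>By disjointness the \<open>m + 1\<close> equal measures add up to at most the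
    measure of all lines meeting \<open>cball 0 r\<close>.\<close>
  have "real (m + 1) * measure \<mu> (hitting_lines (cball 0 r) \<inter> hitting_lines (cball w r)) = (\<Sum>k\<le>m. measure \<mu> (E k))"
    by (simp add: ME)
  also have "\<dots> = measure \<mu> (\<Union>k\<in>{..m}. E k)"
    using Em disj by (intro measure_UNION'[symmetric]) (auto simp: pairwise_def disjnt_def)
  also have "\<dots> \<le> measure \<mu> (hitting_lines (cball 0 r))"
  proof (rule measure_mono_fmeasurable)
    show "(\<Union>k\<in>{..m}. E k) \<in> sets \<mu>" using Em by (intro sets.finite_UN) (auto simp: fmeasurable_def)
    show "hitting_lines (cball 0 r) \<in> fmeasurable \<mu>" by (rule hitting_lines_fmeasurable) simp
  qed (auto simp: E_def)
  finally have *: "(real m + 1) * measure \<mu> (hitting_lines (cball 0 r) \<inter> hitting_lines (cball w r))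
      \<le> measure \<mu> (hitting_lines (cball 0 r))" by (simp add: add.commute)
  have "norm w * measure \<mu> (hitting_lines (cball 0 r) \<inter> hitting_lines (cball w r))
     \<le> 9 * r * (real m + 1) * measure \<mu> (hitting_lines (cball 0 r) \<inter> hitting_lines (cball w r))"
    using m' by (intro mult_right_mono) (auto simp: \<rho>_def)
  also have "\<dots> \<le> 9 * r * measure \<mu> (hitting_lines (cball 0 r))"
    using mult_left_mono[OF *, of "9 * r"] r by (simp add: mult.assoc)
  finally show ?thesis by (simp add: mult.commute)
qed

end

section \<open>Lattice points near a line\<close>

lemma real_point_diff: "real_point (x - y) = real_point x - real_point y"
  by (simp add: real_point_def vec_eq_iff)

lemma real_point_nth: "real_point z $ i = real_of_int (z $ i)"
  by (simp add: real_point_def)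

lemma unit_box_iff: "x \<in> unit_box z \<longleftrightarrow> (\<forall>i. \<bar>x $ i - real_of_int (z $ i)\<bar> \<le> 1/2)"
proof
  assume "x \<in> unit_box z"
  then obtain y where y: "x = real_point z + y" "\<And>i. y $ i \<in> {-1/2..1/2}"
    by (auto simp: unit_box_def)
  have "\<bar>y $ i\<bar> \<le> 1/2" for i using y(2)[of i] by auto
  then show "\<forall>i. \<bar>x $ i - real_of_int (z $ i)\<bar> \<le> 1/2" by (simp add: y(1) real_point_nth)
next
  assume *: "\<forall>i. \<bar>x $ i - real_of_int (z $ i)\<bar> \<le> 1/2"
  have "x = real_point z + (x - real_point z)" by simp
  moreover have "(x - real_point z) $ i \<in> {-1/2..1/2}" for i
    using *[rule_format, of i] by (auto simp: real_point_nth abs_if split: if_splits)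
  ultimately show "x \<in> unit_box z" unfolding unit_box_def by blast
qed

lemma unit_box_eq_cbox:
  "unit_box z = cbox (\<chi> i. real_of_int (z $ i) - 1/2) (\<chi> i. real_of_int (z $ i) + 1/2)"
proof -
  have "\<bar>a - b\<bar> \<le> 1/2 \<longleftrightarrow> b - 1/2 \<le> a \<and> a \<le> b + 1/2" for a b :: real by linarith
  then show ?thesis by (intro set_eqI) (simp only: unit_box_iff mem_box_cart vec_lambda_beta)
qed

lemma compact_unit_box: "compact (unit_box z)"
  unfolding unit_box_eq_cbox by (rule compact_cbox)

lemma compact_boxes: "finite A \<Longrightarrow> compact (boxes A)"
  unfolding boxes_def by (intro compact_UN compact_unit_box) auto

lemma norm_le_CARD:
  fixes x :: "real ^ 'd::finite"
  assumes "\<And>i. \<bar>x $ i\<bar> \<le> c"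
  shows "norm x \<le> real CARD('d) * c"
proof -
  have "norm x \<le> (\<Sum>i\<in>UNIV. \<bar>x $ i\<bar>)" by (rule norm_le_l1_cart)
  also have "\<dots> \<le> (\<Sum>i\<in>(UNIV :: 'd set). c)" by (intro sum_mono assms)
  finally show ?thesis by simp
qed

text \<open>Half the diagonal would do; the radius \<open>CARD('d)\<close> results from bounding the
  Euclidean norm by the l1 norm.\<close>

lemma unit_box_subset_cball:
  fixes z :: "int ^ 'd::finite"
  shows "unit_box z \<subseteq> cball (real_point z) (real CARD('d))"
proof
  fix x assume "x \<in> unit_box z"
  then have "\<bar>x $ i - real_of_int (z $ i)\<bar> \<le> 1/2" for i by (simp add: unit_box_iff)
  note * = this
  have "\<bar>(x - real_point z) $ i\<bar> \<le> 1" for i using *[of i] by (simp add: real_point_nth)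
  from norm_le_CARD[of "x - real_point z", OF this] show "x \<in> cball (real_point z) (real CARD('d))"
    by (simp add: dist_norm norm_minus_commute)
qed

lemma cball_subset_unit_box: "cball (real_point z) (1/2) \<subseteq> unit_box z"
proof
  fix x assume "x \<in> cball (real_point z) (1/2)"
  then have "norm (x - real_point z) \<le> 1/2" by (simp add: dist_norm norm_minus_commute)
  then have "\<bar>(x - real_point z) $ i\<bar> \<le> 1/2" for i
    using component_le_norm_cart order_trans by blast
  then show "x \<in> unit_box z" by (simp add: unit_box_iff real_point_nth)
qed

lemma finite_lattice_ball: "finite {w :: int ^ 'd::finite. norm (real_point w) \<le> \<rho>}"
proof -
  have "finite (PiE (UNIV :: 'd set) (\<lambda>_. {-\<lceil>\<rho>\<rceil>..\<lceil>\<rho>\<rceil>}))" by (intro finite_PiE) auto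
  moreover have "vec_nth ` {w :: int ^ 'd. norm (real_point w) \<le> \<rho>} \<subseteq> PiE (UNIV :: 'd set) (\<lambda>_. {-\<lceil>\<rho>\<rceil>..\<lceil>\<rho>\<rceil>})"
  proof (intro image_subsetI PiE_I)
    fix w :: "int ^ 'd" and i assume "w \<in> {w. norm (real_point w) \<le> \<rho>}"
    then have "\<bar>real_of_int (w $ i)\<bar> \<le> \<rho>"
      using component_le_norm_cart[of "real_point w" i] by (simp add: real_point_nth)
    then have "- \<lceil>\<rho>\<rceil> \<le> w $ i \<and> w $ i \<le> \<lceil>\<rho>\<rceil>" by linarith
    then show "w $ i \<in> {-\<lceil>\<rho>\<rceil>..\<lceil>\<rho>\<rceil>}" by simp
  qed simp
  ultimately have "finite (vec_nth ` {w :: int ^ 'd. norm (real_point w) \<le> \<rho>})" by (rule rev_finite_subset)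
  moreover have "inj_on vec_nth {w :: int ^ 'd. norm (real_point w) \<le> \<rho>}"
    by (auto intro!: inj_onI simp: vec_eq_iff)
  ultimately show ?thesis by (rule finite_imageD)
qed

text \<open>Rounding the centre \<open>x\<close> down coordinatewise gives a lattice point
  \<open>y\<close> within \<open>CARD('d)\<close> of it; translation by \<open>- y\<close> then
  embeds the lattice points of the ball into a slightly larger ball around the origin. This makes
  the bound uniform in \<open>x\<close>.\<close>

lemma lattice_ball_translate:
  fixes x :: "real ^ 'd::finite"
  shows "finite {w :: int ^ 'd. norm (real_point w - x) \<le> \<rho>}"
    and "card {w :: int ^ 'd. norm (real_point w - x) \<le> \<rho>}
      \<le> card {w :: int ^ 'd. norm (real_point w) \<le> \<rho> + real CARD('d)}"
proof -
  define y :: "int ^ 'd" where "y = (\<chi> i. \<lfloor>x $ i\<rfloor>)"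
  have "\<bar>(x - real_point y) $ i\<bar> \<le> 1" for i by (simp add: y_def real_point_nth) linarith
  then have y: "norm (x - real_point y) \<le> real CARD('d)" using norm_le_CARD[of "x - real_point y" 1] by simp
  have inj: "inj_on (\<lambda>w. w - y) {w. norm (real_point w - x) \<le> \<rho>}" by (auto intro: inj_onI)
  have sub: "(\<lambda>w. w - y) ` {w. norm (real_point w - x) \<le> \<rho>} \<subseteq> {w. norm (real_point w) \<le> \<rho> + real CARD('d)}"
  proof (intro image_subsetI)
    fix w assume "w \<in> {w. norm (real_point w - x) \<le> \<rho>}"
    then show "w - y \<in> {w. norm (real_point w) \<le> \<rho> + real CARD('d)}"
      using norm_triangle_ineq[of "real_point w - x" "x - real_point y"] y by (simp add: real_point_diff)
  qed
  show "finite {w :: int ^ 'd. norm (real_point w - x) \<le> \<rho>}"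
    using inj sub finite_lattice_ball by (rule inj_on_finite)
  show "card {w :: int ^ 'd. norm (real_point w - x) \<le> \<rho>}
      \<le> card {w :: int ^ 'd. norm (real_point w) \<le> \<rho> + real CARD('d)}"
    using inj sub finite_lattice_ball by (rule card_inj_on_le)
qed

text \<open>Each box meeting \<open>L\<close> has its centre within bounded distance of a point
  \<open>b + k *\<^sub>R u\<close> with \<open>k\<close> an integer, and only \<open>O(R)\<close>
  values of \<open>k\<close> are compatible with distance at most \<open>R\<close> from
  \<open>z\<close>.\<close>

lemma card_boxes_on_line_le:
  obtains C :: real where "0 < C"
    "\<And>L (z :: int ^ 'd::finite) R. L \<in> affine_lines \<Longrightarrow> 1 \<le> R \<Longrightarrow>
      real (card {w. unit_box w \<inter> L \<noteq> {} \<and> norm (real_point w - real_point z) \<le> R}) \<le> C * R"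
proof
  define D where "D = real CARD('d)"
  \<comment> \<open>\<open>2 * D + 1\<close> consists of \<open>D\<close> from the centre to a point
    \<open>x\<close> of the line in its box, \<open>D\<close> from \<open>x\<close> to the
    projection of the centre, and 1 for rounding the parameter; the last \<open>D\<close> is the
    loss in \<open>lattice_ball_translate\<close>.\<close>
  define K where "K = card {w :: int ^ 'd. norm (real_point w) \<le> 2 * D + 1 + D}"
  show "0 < 4 * (real K + 1)" by simp
  fix L :: "(real ^ 'd) set" and z :: "int ^ 'd" and R :: real
  assume L: "L \<in> affine_lines" and R: "1 \<le> R"
  obtain b u where bu: "norm u = 1" "L = line_through (b, u)" using L by (elim affine_lines_E)
  have uu: "u \<bullet> u = 1" using bu(1) by (simp add: dot_square_norm)
  define t where "t w = (real_point w - b) \<bullet> u" for w :: "int ^ 'd"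
  let ?T = "{w. unit_box w \<inter> L \<noteq> {} \<and> norm (real_point w - real_point z) \<le> R}"
  let ?J = "{\<lfloor>t z - R\<rfloor>..\<lfloor>t z + R\<rfloor>}"
  let ?B = "\<lambda>k :: int. {w :: int ^ 'd. norm (real_point w - (b + real_of_int k *\<^sub>R u)) \<le> 2 * D + 1}"
  have "?T \<subseteq> (\<Union>k\<in>?J. ?B k)"
  proof
    fix w assume "w \<in> ?T"
    then obtain x where wR: "norm (real_point w - real_point z) \<le> R" and x: "x \<in> unit_box w" "x \<in> L"
      by blast
    have nx: "norm (real_point w - x) \<le> D"
      using x(1) unit_box_subset_cball[of w] by (auto simp: D_def dist_norm)
    obtain \<tau> where tau: "x = b + \<tau> *\<^sub>R u" using x(2) bu(2) by (auto simp: line_through_def)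
    have "t w - \<tau> = (real_point w - x) \<bullet> u"
      unfolding t_def tau using uu by (simp add: inner_diff_left inner_add_left)
    then have tw: "\<bar>\<tau> - t w\<bar> \<le> D"
      using Cauchy_Schwarz_ineq2[of "real_point w - x" u] nx bu(1) by (simp add: abs_minus_commute)
    have "real_point w - (b + real_of_int \<lfloor>t w\<rfloor> *\<^sub>R u)
       = (real_point w - x) + (\<tau> - t w) *\<^sub>R u + (t w - real_of_int \<lfloor>t w\<rfloor>) *\<^sub>R u"
      by (simp add: tau algebra_simps)
    also have "norm \<dots> \<le> norm (real_point w - x) + norm ((\<tau> - t w) *\<^sub>R u) + norm ((t w - real_of_int \<lfloor>t w\<rfloor>) *\<^sub>R u)"
      by (intro order_trans[OF norm_triangle_ineq] add_mono norm_triangle_ineq order_refl)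
    also have "norm ((t w - real_of_int \<lfloor>t w\<rfloor>) *\<^sub>R u) = \<bar>t w - real_of_int \<lfloor>t w\<rfloor>\<bar>" using bu(1) by simp
    also have "norm ((\<tau> - t w) *\<^sub>R u) = \<bar>\<tau> - t w\<bar>" using bu(1) by simp
    finally have B: "w \<in> ?B \<lfloor>t w\<rfloor>" using nx tw by simp linarith
    have "t w - t z = (real_point w - real_point z) \<bullet> u" by (simp add: t_def inner_diff_left)
    then have "\<bar>t w - t z\<bar> \<le> R"
      using Cauchy_Schwarz_ineq2[of "real_point w - real_point z" u] wR bu(1) by simp
    then have "\<lfloor>t w\<rfloor> \<in> ?J" by (auto intro!: floor_mono simp: abs_le_iff)
    then show "w \<in> (\<Union>k\<in>?J. ?B k)" using B by blast
  qed
  then have "card ?T \<le> card (\<Union>k\<in>?J. ?B k)"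
    by (intro card_mono finite_UN_I lattice_ball_translate) auto
  also have "\<dots> \<le> (\<Sum>k\<in>?J. card (?B k))" by (rule card_UN_le) simp
  also have "\<dots> \<le> (\<Sum>k\<in>?J. K)"
    unfolding K_def D_def by (intro sum_mono lattice_ball_translate)
  also have "\<dots> = nat (\<lfloor>t z + R\<rfloor> - \<lfloor>t z - R\<rfloor> + 1) * K" by simp
  finally have "real (card ?T) \<le> real (nat (\<lfloor>t z + R\<rfloor> - \<lfloor>t z - R\<rfloor> + 1)) * real K"
    by (simp only: of_nat_le_iff flip: of_nat_mult)
  also have "\<dots> \<le> (4 * R) * (real K + 1)"
  proof (intro mult_mono)
    \<comment> \<open>The index range has at most \<open>2 * R + 2\<close> elements, which
      \<open>1 \<le> R\<close> turns into \<open>4 * R\<close>.\<close>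
    show "real (nat (\<lfloor>t z + R\<rfloor> - \<lfloor>t z - R\<rfloor> + 1)) \<le> 4 * R" using R by linarith
  qed (use R in auto)
  finally show "real (card ?T) \<le> 4 * (real K + 1) * R" by (simp add: mult_ac)
qed

section \<open>The measure of the lines meeting a union of boxes\<close>

text \<open>
  Integrate \<open>1\<^bsub>X > 0\<^esub> \<ge> 2 X / t - X\<^sup>2 / t\<^sup>2\<close>, where \<open>X\<close> counts the sets \<open>H i\<close> containing a point.
\<close>

lemma measure_UN_ge_second_moment:
  fixes H :: "'i \<Rightarrow> 'a set"
  assumes fin: "finite I" and H: "\<And>i. i \<in> I \<Longrightarrow> H i \<in> fmeasurable M" and t: "0 < t"
  shows "2 / t * (\<Sum>i\<in>I. measure M (H i)) - 1 / t\<^sup>2 * (\<Sum>i\<in>I. \<Sum>j\<in>I. measure M (H i \<inter> H j))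
    \<le> measure M (\<Union>i\<in>I. H i)"
proof -
  let ?X = "\<lambda>x. \<Sum>i\<in>I. indicat_real (H i) x"
  have int: "integrable M (indicat_real (H i))" if "i \<in> I" for i
    using H[OF that] by (simp add: fmeasurable_def)
  have int2: "integrable M (indicat_real (H i \<inter> H j))" if "i \<in> I" "j \<in> I" for i j
    using fmeasurable.Int[OF H[OF that(1)] H[OF that(2)]] by (simp add: fmeasurable_def)
  have U: "(\<Union>i\<in>I. H i) \<in> fmeasurable M" using fin H by (intro fmeasurable.finite_UN) auto
  have pt: "2 / t * ?X x - 1 / t\<^sup>2 * (\<Sum>i\<in>I. \<Sum>j\<in>I. indicat_real (H i \<inter> H j) x) \<le> indicat_real (\<Union>i\<in>I. H i) x" for x
  proof (cases "x \<in> (\<Union>i\<in>I. H i)")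
    case True
    have "(\<Sum>i\<in>I. \<Sum>j\<in>I. indicat_real (H i \<inter> H j) x) = (?X x)\<^sup>2"
      by (simp add: power2_eq_square sum_product indicator_inter_arith)
    moreover have "0 \<le> (?X x / t - 1)\<^sup>2" by simp
    ultimately show ?thesis using True t by (simp add: power2_eq_square field_simps)
  next
    case False
    then have "indicat_real (H i) x = 0" if "i \<in> I" for i using that by (auto simp: indicator_def)
    then show ?thesis using False by (simp add: indicator_inter_arith)
  qed
  have "has_bochner_integral M
      (\<lambda>x. 2 / t * ?X x - 1 / t\<^sup>2 * (\<Sum>i\<in>I. \<Sum>j\<in>I. indicat_real (H i \<inter> H j) x))
      (2 / t * (\<Sum>i\<in>I. measure M (H i)) - 1 / t\<^sup>2 * (\<Sum>i\<in>I. \<Sum>j\<in>I. measure M (H i \<inter> H j)))"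
    using H fmeasurable.Int[OF H H]
    by (intro has_bochner_integral_diff has_bochner_integral_mult_right has_bochner_integral_sum
        has_bochner_integral_real_indicator) (auto simp: fmeasurable_def)
  then have "2 / t * (\<Sum>i\<in>I. measure M (H i)) - 1 / t\<^sup>2 * (\<Sum>i\<in>I. \<Sum>j\<in>I. measure M (H i \<inter> H j))
     = (LINT x|M. 2 / t * ?X x - 1 / t\<^sup>2 * (\<Sum>i\<in>I. \<Sum>j\<in>I. indicat_real (H i \<inter> H j) x))"
    by (rule has_bochner_integral_integral_eq[symmetric])
  also have "\<dots> \<le> (LINT x|M. indicat_real (\<Union>i\<in>I. H i) x)"
    using int int2 U pt by (intro integral_mono) (auto simp: fmeasurable_def)
  also have "\<dots> = measure M (\<Union>i\<in>I. H i)" using U by simp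
  finally show ?thesis .
qed

abbreviation box_lines :: "int ^ 'd::finite \<Rightarrow> (real ^ 'd) set set" where
  "box_lines z \<equiv> hitting_lines (unit_box z)"

section \<open>Hitting measures of one box, two boxes and a finite union\<close>

context
  fixes \<mu> :: "(real ^ 'd::finite) set measure"
  assumes inv: "invariant_line_measure \<mu>"
begin

lemma box_lines_fmeasurable: "box_lines z \<in> fmeasurable \<mu>"
  by (intro hitting_lines_fmeasurable[OF inv] compact_unit_box)

text \<open>Lower bound through the inscribed ball of radius 1/2, whose hitting measure is the same
  for every centre.\<close>

lemma measure_hitting_unit_box_ge:
  obtains c where "0 < c" "\<And>z :: int ^ 'd. c \<le> measure \<mu> (box_lines z)"
proof
  show "0 < measure \<mu> (hitting_lines (cball 0 (1/2)))"
    using emeasure_hitting_lines_cball_pos[OF inv, of "1/2" 0] emeasure_hitting_lines_cball_finite[OF inv, of 0 "1/2"]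
    by (simp add: measure_def enn2real_positive_iff)
  fix z :: "int ^ 'd"
  have "measure \<mu> (hitting_lines (cball 0 (1/2))) = measure \<mu> (hitting_lines (cball (real_point z) (1/2)))"
    using emeasure_hitting_lines_cball_translate[OF inv, of "real_point z" "1/2"] by (simp add: measure_def)
  also have "\<dots> \<le> measure \<mu> (box_lines z)"
    by (intro measure_mono_fmeasurable hitting_lines_mono cball_subset_unit_box box_lines_fmeasurable
        fmeasurableD hitting_lines_fmeasurable[OF inv]) auto
  finally show "measure \<mu> (hitting_lines (cball 0 (1/2))) \<le> measure \<mu> (box_lines z)" .
qed

lemma measure_hitting_unit_box_le:
  obtains c where "0 < c" "\<And>z :: int ^ 'd. measure \<mu> (box_lines z) \<le> c"
proof
  define D where "D = real CARD('d)"
  show "0 < measure \<mu> (hitting_lines (cball 0 D)) + 1" by (simp add: add_nonneg_pos)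
  fix z :: "int ^ 'd"
  have "measure \<mu> (box_lines z) \<le> measure \<mu> (hitting_lines (cball (real_point z) D))"
    unfolding D_def by (intro measure_mono_fmeasurable hitting_lines_mono unit_box_subset_cball box_lines_fmeasurable
        fmeasurableD hitting_lines_fmeasurable[OF inv]) auto
  also have "\<dots> = measure \<mu> (hitting_lines (cball 0 D))"
    using emeasure_hitting_lines_cball_translate[OF inv, of "real_point z" D] by (simp add: measure_def)
  finally show "measure \<mu> (box_lines z) \<le> measure \<mu> (hitting_lines (cball 0 D)) + 1" by simp
qed

text \<open>The boxes are enlarged to balls of radius \<open>D\<close> and translated so that the
  first is centred at the origin; then the two-ball estimate applies.\<close>

lemma measure_Int_hitting_unit_boxes_le:
  assumes d: "CARD('d) \<ge> 2"
  obtains c where "0 < c"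
    "\<And>z w :: int ^ 'd. measure \<mu> (box_lines z \<inter> box_lines w) * norm (real_point w - real_point z) \<le> c"
proof
  define D where "D = real CARD('d)"
  define c where "c = 9 * D * measure \<mu> (hitting_lines (cball 0 D)) + 1"
  have D: "0 < D" by (simp add: D_def)
  show "0 < c" using D by (simp add: c_def add_nonneg_pos)
  fix z w :: "int ^ 'd"
  let ?v = "real_point w - real_point z"
  have "measure \<mu> (box_lines z \<inter> box_lines w) \<le> measure \<mu> (hitting_lines (cball (real_point z) D) \<inter> hitting_lines (cball (real_point w) D))"
    unfolding D_def by (intro measure_mono_fmeasurable Int_mono hitting_lines_mono unit_box_subset_cball
        fmeasurable.Int fmeasurableD hitting_lines_fmeasurable[OF inv] compact_unit_box compact_cball)
  also have "\<dots> = measure \<mu> (hitting_lines (cball 0 D) \<inter> hitting_lines (cball ?v D))"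
    using emeasure_Int_hitting_lines_motion[OF inv euclidean_motion_translation[of "real_point z"], of "cball 0 D" "cball ?v D"]
    by (simp add: measure_def flip: cball_translation)
  finally have "measure \<mu> (box_lines z \<inter> box_lines w) * norm ?v
      \<le> measure \<mu> (hitting_lines (cball 0 D) \<inter> hitting_lines (cball ?v D)) * norm ?v"
    by (intro mult_right_mono) auto
  also have "\<dots> \<le> 9 * D * measure \<mu> (hitting_lines (cball 0 D))"
    by (rule measure_Int_hitting_balls_le[OF inv d D])
  finally show "measure \<mu> (box_lines z \<inter> box_lines w) * norm ?v \<le> c" by (simp add: c_def)
qed

text \<open>Boxes at distance at most \<open>R\<close> from \<open>z\<close> are counted along each
  line; each of the farther ones contributes at most \<open>c / R\<close>. With
  \<open>R\<^sup>2 = card A\<close> both parts are of order \<open>R\<close>.\<close>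

lemma sum_measure_Int_hitting_le:
  assumes d: "CARD('d) \<ge> 2"
  obtains C where "0 < C"
    "\<And>(A :: (int ^ 'd) set) z. finite A \<Longrightarrow> A \<noteq> {} \<Longrightarrow> (\<Sum>w\<in>A. measure \<mu> (box_lines z \<inter> box_lines w)) \<le> C * sqrt (card A)"
proof -
  obtain C1 where C1: "0 < C1" "\<And>L (z :: int ^ 'd) R. L \<in> affine_lines \<Longrightarrow> 1 \<le> R \<Longrightarrow>
      real (card {w. unit_box w \<inter> L \<noteq> {} \<and> norm (real_point w - real_point z) \<le> R}) \<le> C1 * R"
    using card_boxes_on_line_le by blast
  obtain c where c: "0 < c" "\<And>z w :: int ^ 'd. measure \<mu> (box_lines z \<inter> box_lines w) * norm (real_point w - real_point z) \<le> c"
    using measure_Int_hitting_unit_boxes_le[OF d] by blast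
  obtain h where h: "0 < h" "\<And>z :: int ^ 'd. measure \<mu> (box_lines z) \<le> h"
    using measure_hitting_unit_box_le by blast
  have "(\<Sum>w\<in>A. measure \<mu> (box_lines z \<inter> box_lines w)) \<le> (C1 * h + c) * sqrt (card A)"
    if fin: "finite A" and ne: "A \<noteq> {}" for A :: "(int ^ 'd) set" and z
  proof -
    define R where "R = sqrt (card A)"
    have R: "1 \<le> R" using fin ne by (simp add: R_def card_gt_0_iff Suc_leI)
    have RR: "R * R = real (card A)" by (simp add: R_def)
    define N where "N = {w \<in> A. norm (real_point w - real_point z) \<le> R}"
    have N: "finite N" "N \<subseteq> A" using fin by (auto simp: N_def)
    \<comment> \<open>Near part: the sum is the integral, over the lines meeting the box of
      \<open>z\<close>, of the number of near boxes that a line meets, and this number is at most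
      \<open>C1 * R\<close>.\<close>
    have "(\<Sum>w\<in>N. measure \<mu> (box_lines z \<inter> box_lines w)) = (\<Sum>w\<in>N. (LINT L|\<mu>. indicat_real (box_lines z \<inter> box_lines w) L))"
      using fmeasurable.Int[OF box_lines_fmeasurable box_lines_fmeasurable] by simp
    also have "\<dots> = (LINT L|\<mu>. (\<Sum>w\<in>N. indicat_real (box_lines z \<inter> box_lines w) L))"
      using fmeasurable.Int[OF box_lines_fmeasurable box_lines_fmeasurable]
      by (intro Bochner_Integration.integral_sum[symmetric]) (auto simp: fmeasurable_def)
    also have "\<dots> \<le> (LINT L|\<mu>. (C1 * R) * indicat_real (box_lines z) L)"
    proof (rule integral_mono)
      show "integrable \<mu> (\<lambda>L. \<Sum>w\<in>N. indicat_real (box_lines z \<inter> box_lines w) L)"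
        using fmeasurable.Int[OF box_lines_fmeasurable box_lines_fmeasurable] by (auto simp: fmeasurable_def)
      show "integrable \<mu> (\<lambda>L. (C1 * R) * indicat_real (box_lines z) L)"
        using box_lines_fmeasurable by (auto simp: fmeasurable_def)
      fix L assume "L \<in> space \<mu>"
      show "(\<Sum>w\<in>N. indicat_real (box_lines z \<inter> box_lines w) L) \<le> (C1 * R) * indicat_real (box_lines z) L"
      proof (cases "L \<in> box_lines z")
        case True
        then have L: "L \<in> affine_lines" by (simp add: hitting_lines_def)
        have "(\<Sum>w\<in>N. indicat_real (box_lines z \<inter> box_lines w) L) = (\<Sum>w\<in>N. indicat_real {w. unit_box w \<inter> L \<noteq> {}} w)"
          using True L by (intro sum.cong) (auto simp: indicator_def hitting_lines_def)
        also have "\<dots> = real (card (N \<inter> {w. unit_box w \<inter> L \<noteq> {}}))"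
          using N(1) by (simp add: indicator_def of_bool_def sum.If_cases)
        also have "\<dots> \<le> real (card {w. unit_box w \<inter> L \<noteq> {} \<and> norm (real_point w - real_point z) \<le> R})"
          by (intro of_nat_mono card_mono) (auto simp: N_def intro: finite_subset[OF _ lattice_ball_translate(1)])
        also have "\<dots> \<le> C1 * R" by (rule C1(2)[OF L R])
        finally show ?thesis using True by simp
      qed (simp add: indicator_inter_arith)
    qed
    also have "\<dots> = (C1 * R) * measure \<mu> (box_lines z)" using box_lines_fmeasurable by simp
    also have "\<dots> \<le> (C1 * R) * h" using C1(1) R by (intro mult_left_mono h) auto
    finally have near: "(\<Sum>w\<in>N. measure \<mu> (box_lines z \<inter> box_lines w)) \<le> (C1 * R) * h" .
    have "(\<Sum>w\<in>A - N. measure \<mu> (box_lines z \<inter> box_lines w)) \<le> (\<Sum>w\<in>A - N. c / R)"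
    proof (rule sum_mono)
      fix w assume "w \<in> A - N"
      then have "R \<le> norm (real_point w - real_point z)" by (auto simp: N_def)
      then have "measure \<mu> (box_lines z \<inter> box_lines w) * R \<le> measure \<mu> (box_lines z \<inter> box_lines w) * norm (real_point w - real_point z)"
        by (intro mult_left_mono) auto
      then have "measure \<mu> (box_lines z \<inter> box_lines w) * R \<le> c" using c(2)[of z w] by linarith
      then show "measure \<mu> (box_lines z \<inter> box_lines w) \<le> c / R" using R by (simp add: field_simps)
    qed
    also have "\<dots> \<le> real (card A) * (c / R)"
      using fin c R by (simp) (intro divide_right_mono mult_right_mono of_nat_mono card_mono; auto)
    also have "\<dots> = c * R" using R by (simp add: RR[symmetric])
    finally have "(\<Sum>w\<in>A - N. measure \<mu> (box_lines z \<inter> box_lines w)) \<le> c * R" .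
    with near have "(\<Sum>w\<in>A. measure \<mu> (box_lines z \<inter> box_lines w)) \<le> (C1 * h + c) * R"
      using sum.subset_diff[OF N(2) fin, of "\<lambda>w. measure \<mu> (box_lines z \<inter> box_lines w)"] by (simp add: algebra_simps)
    then show ?thesis by (simp add: R_def)
  qed
  moreover have "0 < C1 * h + c" using C1 h c by (simp add: add_pos_pos)
  ultimately show thesis using that by blast
qed

text \<open>Second moment method: the first moment is at least \<open>c * card A\<close>, the second
  at most \<open>C * sqrt (card A) * card A\<close>.\<close>

lemma measure_hitting_boxes_ge:
  assumes d: "CARD('d) \<ge> 2"
  obtains c where "0 < c"
    "\<And>A :: (int ^ 'd) set. finite A \<Longrightarrow> c * sqrt (card A) \<le> measure \<mu> (hitting_lines (boxes A))"
proof -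
  obtain c where c: "0 < c" "\<And>z :: int ^ 'd. c \<le> measure \<mu> (box_lines z)"
    using measure_hitting_unit_box_ge by blast
  obtain C where C: "0 < C" "\<And>(A :: (int ^ 'd) set) z. finite A \<Longrightarrow> A \<noteq> {} \<Longrightarrow>
      (\<Sum>w\<in>A. measure \<mu> (box_lines z \<inter> box_lines w)) \<le> C * sqrt (card A)"
    using sum_measure_Int_hitting_le[OF d] by blast
  have "c\<^sup>2 / C * sqrt (card A) \<le> measure \<mu> (hitting_lines (boxes A))"
    if fin: "finite A" for A :: "(int ^ 'd) set"
  proof (cases "A = {}")
    case False
    define s where "s = sqrt (card A)"
    have s: "0 < s" and ss: "s * s = real (card A)" using fin False by (auto simp: s_def card_gt_0_iff)
    \<comment> \<open>The ratio of the two moment bounds; this choice of \<open>t\<close> maximizes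
      the resulting lower bound.\<close>
    define t where "t = C * s / c"
    have t: "0 < t" using C c s by (simp add: t_def)
    have "real (card A) * c = (\<Sum>z\<in>A. c)" by simp
    also have "\<dots> \<le> (\<Sum>z\<in>A. measure \<mu> (box_lines z))" by (intro sum_mono c)
    finally have 1: "2 / t * (s * s * c) \<le> 2 / t * (\<Sum>z\<in>A. measure \<mu> (box_lines z))"
      using t ss by (intro mult_left_mono) auto
    have "(\<Sum>z\<in>A. \<Sum>w\<in>A. measure \<mu> (box_lines z \<inter> box_lines w)) \<le> (\<Sum>z\<in>A. C * s)"
      unfolding s_def by (intro sum_mono C fin False)
    also have "\<dots> = s * s * (C * s)" by (simp add: ss)
    finally have 2: "1 / t\<^sup>2 * (\<Sum>z\<in>A. \<Sum>w\<in>A. measure \<mu> (box_lines z \<inter> box_lines w)) \<le> 1 / t\<^sup>2 * (s * s * (C * s))"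
      by (intro mult_left_mono) auto
    have "c\<^sup>2 / C * s = 2 / t * (s * s * c) - 1 / t\<^sup>2 * (s * s * (C * s))"
      using s C c by (simp add: t_def power2_eq_square field_simps)
    also have "\<dots> \<le> measure \<mu> (\<Union>z\<in>A. box_lines z)"
      using 1 2 measure_UN_ge_second_moment[OF fin, of box_lines \<mu> t, OF box_lines_fmeasurable t] by linarith
    finally show ?thesis by (simp add: s_def boxes_def hitting_lines_UN)
  qed simp
  moreover have "0 < c\<^sup>2 / C" using c C by simp
  ultimately show thesis using that by blast
qed

end

section \<open>Bounds on the ballistic measure\<close>

lemma mem_unit_box_round: "x \<in> unit_box (\<chi> i. \<lfloor>x $ i + 1/2\<rfloor>)"
proof -
  have "\<bar>a - real_of_int \<lfloor>a + 1/2\<rfloor>\<bar> \<le> 1/2" for a :: real by linarith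
  then show ?thesis by (simp only: unit_box_iff vec_lambda_beta) blast
qed

lemma finite_outer_boundary:
  fixes A :: "(int ^ 'd::finite) set"
  assumes "finite A" shows "finite (outer_boundary A)"
proof (rule finite_subset)
  show "outer_boundary A \<subseteq> (\<Union>x\<in>A. {y. norm (real_point y - real_point x) \<le> 1})"
    by (auto simp: outer_boundary_def neighbours_def)
  show "finite (\<Union>x\<in>A. {y. norm (real_point y - real_point x) \<le> 1})"
    using assms lattice_ball_translate(1) by blast
qed

text \<open>Centres of boxes containing \<open>p\<close> differ by at most 1 in each coordinate, so
  a path of neighbours among them leads from \<open>z\<close> to \<open>w\<close>; where it first
  leaves \<open>A\<close> it enters the outer boundary.\<close>

lemma common_point_in_outer_boundary_box:
  fixes A :: "(int ^ 'd::finite) set"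
  assumes z: "z \<in> A" "p \<in> unit_box z" and w: "w \<notin> A" "p \<in> unit_box w"
  shows "p \<in> boxes (outer_boundary A)"
proof (rule ccontr)
  assume neg: "p \<notin> boxes (outer_boundary A)"
  \<comment> \<open>change \<open>z\<close> into \<open>w\<close> one coordinate at a time\<close>
  define mix where "mix I = (\<chi> i. if i \<in> I then w $ i else z $ i)" for I
  have box: "p \<in> unit_box (mix I)" for I
    using z(2) w(2) by (simp add: unit_box_iff mix_def)
  have mix: "mix I \<in> A" if "finite I" for I
    using that
  proof (induction I rule: finite_induct)
    case empty
    have "mix {} = z" by (simp add: mix_def vec_eq_iff)
    then show ?case using z by simp
  next
    case (insert i I)
    show ?case
    proof (rule ccontr)
      assume out: "mix (insert i I) \<notin> A"
      have "mix (insert i I) \<noteq> mix I" using out insert by metis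
      then have ne: "w $ i \<noteq> z $ i" using insert(2) by (auto simp: mix_def vec_eq_iff split: if_splits)
      have "\<bar>p $ i - real_of_int (z $ i)\<bar> \<le> 1/2" "\<bar>p $ i - real_of_int (w $ i)\<bar> \<le> 1/2"
        using z(2) w(2) by (simp_all add: unit_box_iff)
      then have "\<bar>real_of_int (w $ i) - real_of_int (z $ i)\<bar> \<le> 1" by linarith
      with ne have one: "\<bar>real_of_int (w $ i - z $ i)\<bar> = 1" by linarith
      have "real_point (mix (insert i I)) - real_point (mix I) = axis i (real_of_int (w $ i - z $ i))"
        using insert(2) by (auto simp: vec_eq_iff real_point_nth mix_def axis_def)
      then have "neighbours (mix (insert i I)) (mix I)"
        using one by (simp add: neighbours_def norm_eq_sqrt_inner inner_axis_axis real_sqrt_abs2 del: of_int_diff)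
      then have "mix (insert i I) \<in> outer_boundary A" using out insert by (auto simp: outer_boundary_def)
      then show False using neg box by (auto simp: boxes_def)
    qed
  qed
  have "mix UNIV = w" by (simp add: mix_def vec_eq_iff)
  then show False using mix[of UNIV] w(1) by simp
qed

text \<open>Since \<open>boxes A\<close> is compact, the line has a last point in it. Points just
  after it lie in boxes outside \<open>A\<close>, so by closedness the last point itself lies in
  such a box and \<open>common_point_in_outer_boundary_box\<close> applies.\<close>

lemma hitting_boxes_subset_boundary:
  fixes A :: "(int ^ 'd::finite) set"
  assumes fin: "finite A"
  shows "hitting_lines (boxes A) \<subseteq> hitting_lines (boxes (outer_boundary A))"
proof
  fix L assume "L \<in> hitting_lines (boxes A)"
  then have L: "L \<in> affine_lines" "L \<inter> boxes A \<noteq> {}" by (auto simp: hitting_lines_def)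
  obtain b u where bu: "norm u = 1" "L = line_through (b, u)" using L(1) by (elim affine_lines_E)
  define f where "f t = b + t *\<^sub>R u" for t
  have fL: "f t \<in> L" for t using bu(2) by (auto simp: f_def line_through_def)
  have fd: "norm (f s - f t) = \<bar>s - t\<bar>" for s t
    using bu(1) by (simp add: f_def flip: scaleR_left_diff_distrib)
  define S where "S = f -` boxes A"
  have cont: "continuous_on UNIV f" unfolding f_def by (intro continuous_intros)
  have "closed S"
    unfolding S_def using compact_imp_closed[OF compact_boxes[OF fin]] cont by (rule closed_vimage)
  moreover have "bounded S"
  proof -
    obtain r where r: "boxes A \<subseteq> cball 0 r"
      using bounded_subset_ballD[OF compact_imp_bounded[OF compact_boxes[OF fin]], of 0] ball_subset_cball by blast
    have "norm t \<le> r + norm b" if "t \<in> S" for t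
    proof -
      have "norm (f t) \<le> r" using that r by (auto simp: S_def)
      then have "norm (f t - b) \<le> r + norm b" using norm_triangle_ineq4[of "f t" b] by linarith
      then show ?thesis using bu(1) by (simp add: f_def)
    qed
    then show ?thesis by (rule boundedI)
  qed
  moreover have "S \<noteq> {}" using L(2) bu(2) by (auto simp: S_def f_def line_through_def)
  \<comment> \<open>the last point of the line in \<open>boxes A\<close> lies in a box outside \<open>A\<close> as well\<close>
  ultimately obtain \<tau> where tau: "\<tau> \<in> S" "\<And>t. t \<in> S \<Longrightarrow> t \<le> \<tau>"
    using compact_attains_sup[of S] by (auto simp: compact_eq_bounded_closed)
  obtain z where z: "z \<in> A" "f \<tau> \<in> unit_box z" using tau(1) by (auto simp: S_def boxes_def)
  define D where "D = real CARD('d)"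
  \<comment> \<open>Finitely many candidates, so that \<open>boxes W\<close> is closed; the radius
    \<open>D + 1\<close> admits every box outside \<open>A\<close> that contains a point within 1 of
    \<open>f \<tau>\<close>.\<close>
  define W where "W = {w. w \<notin> A \<and> norm (real_point w - f \<tau>) \<le> D + 1}"
  have W: "finite W" unfolding W_def by (rule finite_subset[OF _ lattice_ball_translate(1)]) auto
  have "f \<tau> \<in> boxes W"
  proof (rule ccontr)
    assume "f \<tau> \<notin> boxes W"
    moreover have "open (- boxes W)" using compact_imp_closed[OF compact_boxes[OF W]] by (rule open_Compl)
    ultimately obtain e where e: "0 < e" "ball (f \<tau>) e \<subseteq> - boxes W"
      by (metis ComplI open_contains_ball)
    define s where "s = min (e / 2) 1"
    have s: "0 < s" "s < e" "s \<le> 1" using e(1) by (auto simp: s_def)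
    define x where "x = f (\<tau> + s)"
    have dx: "norm (x - f \<tau>) = s" using fd s by (simp add: x_def)
    define w :: "int ^ 'd" where "w = (\<chi> i. \<lfloor>x $ i + 1/2\<rfloor>)"
    have xw: "x \<in> unit_box w" unfolding w_def by (rule mem_unit_box_round)
    have "\<tau> + s \<notin> S" using tau(2) s by force
    then have "w \<notin> A" using xw by (auto simp: S_def boxes_def x_def)
    moreover have "norm (real_point w - x) \<le> D"
      using xw unit_box_subset_cball[of w] by (auto simp: D_def dist_norm)
    then have "norm (real_point w - f \<tau>) \<le> D + 1"
      using norm_triangle_ineq[of "real_point w - x" "x - f \<tau>"] dx s by simp
    ultimately have "w \<in> W" by (simp add: W_def)
    then have "x \<in> boxes W" using xw by (auto simp: boxes_def)
    moreover have "x \<in> ball (f \<tau>) e" using dx s by (simp add: dist_norm norm_minus_commute)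
    ultimately show False using e(2) by blast
  qed
  then obtain w where w: "w \<notin> A" "f \<tau> \<in> unit_box w" by (auto simp: boxes_def W_def)
  have "f \<tau> \<in> boxes (outer_boundary A)" by (rule common_point_in_outer_boundary_box[OF z w])
  then show "L \<in> hitting_lines (boxes (outer_boundary A))" using L(1) fL by (auto simp: hitting_lines_def)
qed

section \<open>Upper bounds on the ballistic measure\<close>

text \<open>A nonzero weight at \<open>z\<close> requires \<open>L\<close> to meet the box of
  \<open>z\<close>, in whatever order the boxes are visited.\<close>

lemma ballistic_weight_le_indicator:
  assumes "L \<in> affine_lines"
  shows "ballistic_weight v A z L \<le> indicat_real (hitting_lines (unit_box z)) L"
proof -
  have "z \<in> points_on_line A L" if "ballistic_weight v A z L \<noteq> 0"
    using that by (auto simp: ballistic_weight_def Let_def is_first_point_def is_last_point_def split: if_splits)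
  then have "L \<in> hitting_lines (unit_box z)" if "ballistic_weight v A z L \<noteq> 0"
    using that assms by (auto simp: points_on_line_def hitting_lines_def)
  moreover have "ballistic_weight v A z L \<le> 1" by (simp add: ballistic_weight_def Let_def)
  ultimately show ?thesis by (cases "ballistic_weight v A z L = 0") auto
qed

text \<open>Ensures below that every added point almost surely lies in the outer boundary.\<close>

lemma ballistic_measure_eq_0: "z \<notin> A \<Longrightarrow> ballistic_measure \<mu> v A z = 0"
proof -
  assume "z \<notin> A"
  then have "ballistic_weight v A z L = 0" for L
    by (auto simp: ballistic_weight_def Let_def is_first_point_def is_last_point_def points_on_line_def)
  then show ?thesis by (simp add: ballistic_measure_def)
qed

lemma ballistic_measure_le:
  assumes inv: "invariant_line_measure \<mu>" and fin: "finite A"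
    and pos: "0 < measure \<mu> (hitting_lines (boxes A))"
  shows "ballistic_measure \<mu> v A z
    \<le> measure \<mu> (hitting_lines (unit_box z)) / measure \<mu> (hitting_lines (boxes A))"
proof -
  let ?S = "hitting_lines (boxes A)" and ?H = "hitting_lines (unit_box z)"
  let ?U = "uniform_measure \<mu> ?S"
  have S: "?S \<in> fmeasurable \<mu>" and H: "?H \<in> fmeasurable \<mu>"
    by (intro hitting_lines_fmeasurable[OF inv] compact_boxes compact_unit_box fin)+
  have ne: "emeasure \<mu> ?S \<noteq> 0" "emeasure \<mu> ?S \<noteq> \<infinity>"
    using pos S by (auto simp: measure_def fmeasurable_def)
  have sp: "space \<mu> = affine_lines"
    using inv sets_eq_imp_space_eq[of \<mu> line_borel] space_line_borel by (auto simp: invariant_line_measure_def)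
  interpret U: prob_space ?U by (rule prob_space_uniform_measure[OF ne])
  have "ballistic_measure \<mu> v A z \<le> (LINT L|?U. indicat_real ?H L)"
    unfolding ballistic_measure_def
  \<comment> \<open>Integrability is asked of the larger function only: a non-integrable weight
    would have Bochner integral 0 by default, and the bound would still hold.\<close>
  proof (rule integral_mono')
    show "integrable ?U (indicat_real ?H)"
      using H by (intro integrable_real_indicator) (auto simp: fmeasurable_def U.emeasure_eq_measure)
  qed (auto simp: sp ballistic_weight_le_indicator)
  also have "\<dots> = measure ?U ?H" using H by (simp add: fmeasurable_def)
  also have "\<dots> = measure \<mu> (?S \<inter> ?H) / measure \<mu> ?S"
    using H ne by (intro measure_uniform_measure) (auto simp: fmeasurable_def)
  also have "\<dots> \<le> measure \<mu> ?H / measure \<mu> ?S"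
    using S H pos by (intro divide_right_mono measure_mono_fmeasurable) (auto simp: fmeasurable_def)
  finally show ?thesis .
qed

text \<open>Every line meeting \<open>boxes A\<close> meets the boxes of the outer boundary, so the
  denominator is at least \<open>c * sqrt (card A)\<close>; the numerator is the measure of the
  lines meeting one box, which is bounded.\<close>

lemma ballistic_measure_outer_boundary_le:
  fixes \<mu> :: "(real, 'd::{finite,linorder}) vec set measure"
  assumes inv: "invariant_line_measure \<mu>" and d: "CARD('d) \<ge> 2"
  obtains C where "0 < C" "\<And>A z. finite A \<Longrightarrow> A \<noteq> {} \<Longrightarrow>
    ballistic_measure \<mu> v (outer_boundary A) z \<le> C / sqrt (card A)"
proof -
  obtain h where h: "0 < h" "\<And>z :: (int, 'd) vec. measure \<mu> (hitting_lines (unit_box z)) \<le> h"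
    using measure_hitting_unit_box_le[OF inv] by blast
  obtain c where c: "0 < c" "\<And>A :: ((int, 'd) vec) set. finite A \<Longrightarrow>
      c * sqrt (card A) \<le> measure \<mu> (hitting_lines (boxes A))"
    using measure_hitting_boxes_ge[OF inv d] by blast
  have "ballistic_measure \<mu> v (outer_boundary A) z \<le> h / c / sqrt (card A)"
    if fin: "finite A" and ne: "A \<noteq> {}" for A z
  proof -
    let ?m = "measure \<mu> (hitting_lines (boxes (outer_boundary A)))"
    have "c * sqrt (card A) \<le> measure \<mu> (hitting_lines (boxes A))" using c(2)[OF fin] .
    also have "\<dots> \<le> ?m"
      using fin by (intro measure_mono_fmeasurable hitting_boxes_subset_boundary fmeasurableD
          hitting_lines_fmeasurable[OF inv] compact_boxes finite_outer_boundary)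
    finally have m: "c * sqrt (card A) \<le> ?m" .
    have pos: "0 < c * sqrt (card A)" using c fin ne by (simp add: card_gt_0_iff)
    have "ballistic_measure \<mu> v (outer_boundary A) z \<le> measure \<mu> (hitting_lines (unit_box z)) / ?m"
      using m pos by (intro ballistic_measure_le[OF inv] finite_outer_boundary fin) linarith
    also have "\<dots> \<le> h / (c * sqrt (card A))"
      using h m pos by (intro frac_le) auto
    finally show ?thesis by simp
  qed
  then show thesis using that[of "h / c"] h c by simp
qed

section \<open>Growth of incremental aggregation\<close>

text \<open>Summability of the tail bounds in the Borel-Cantelli argument.\<close>

lemma summable_exp_minus_sqrt: "summable (\<lambda>n. exp (- sqrt (real (Suc n))))"
proof (rule summable_comparison_test_bigo)
  show "summable (\<lambda>n. norm (1 / real n ^ 2))"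
    using inverse_power_summable[of 2, where 'a = real] by (simp add: field_simps)
  show "(\<lambda>n. exp (- sqrt (real (Suc n)))) \<in> O(\<lambda>n. 1 / real n ^ 2)" by real_asymp
qed

section \<open>From radius growth to the fractal dimension\<close>

text \<open>Eventually the quotient is at least \<open>ln n / (ln K + ln n / 2)\<close>, which tends
  to 2.\<close>

lemma lower_fractal_dimension_ge_2I:
  fixes F :: "nat \<Rightarrow> (int ^ 'd::finite) set"
  assumes fin: "\<And>n. 1 \<le> n \<Longrightarrow> finite (F n)" and card: "\<And>n. 1 \<le> n \<Longrightarrow> card (F n) = n"
    and K: "1 \<le> K" and rad: "eventually (\<lambda>n. rad (F n) \<le> K * sqrt (real n)) sequentially"
  shows "2 \<le> lower_fractal_dimension F"
proof -
  \<comment> \<open>With more than \<open>N\<close> points \<open>F n\<close> cannot fit into the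
    unit ball, so \<open>rad (F n)\<close> exceeds 1 and its logarithm is positive.\<close>
  define N where "N = card {w :: int ^ 'd. norm (real_point w) \<le> 1}"
  have gt1: "1 < rad (F n)" if n: "N + 1 \<le> n" for n
  proof -
    have "\<not> F n \<subseteq> {w. norm (real_point w) \<le> 1}"
      using card_mono[OF finite_lattice_ball[of 1], of "F n"] card[of n] n N_def by auto
    then obtain x where x: "x \<in> F n" "1 < norm (real_point x)" by force
    then have "norm (real_point x) \<le> rad (F n)" unfolding rad_def using fin[of n] n by (intro Max_ge) auto
    then show ?thesis using x by simp
  qed
  have "((\<lambda>n. ln (real n) / (ln K + ln (real n) / 2)) \<longlongrightarrow> 2) sequentially" by real_asymp
  then have "(\<lambda>n. ereal (ln (real n) / (ln K + ln (real n) / 2))) \<longlonglongrightarrow> ereal 2" by simp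
  then have "liminf (\<lambda>n. ereal (ln (real n) / (ln K + ln (real n) / 2))) = ereal 2"
    by (intro lim_imp_Liminf) auto
  moreover have "liminf (\<lambda>n. ereal (ln (real n) / (ln K + ln (real n) / 2))) \<le> lower_fractal_dimension F"
    unfolding lower_fractal_dimension_def
  proof (rule Liminf_mono)
    show "eventually (\<lambda>n. ereal (ln (real n) / (ln K + ln (real n) / 2)) \<le>
        ereal (ln (real (card (F n))) / ln (rad (F n)))) sequentially"
      using rad eventually_ge_at_top[of "N + 1"]
    proof eventually_elim
      case (elim n)
      have r1: "1 < rad (F n)" using gt1 elim by simp
      have "ln (rad (F n)) \<le> ln (K * sqrt (real n))" using elim r1 by (subst ln_le_cancel_iff) auto
      also have "\<dots> = ln K + ln (real n) / 2" using K elim by (simp add: ln_mult ln_sqrt)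
      finally have "ln (rad (F n)) \<le> ln K + ln (real n) / 2" .
      moreover have "0 < ln (rad (F n))" using r1 by simp
      ultimately have "ln (real n) / (ln K + ln (real n) / 2) \<le> ln (real n) / ln (rad (F n))"
        using elim by (intro divide_left_mono mult_pos_pos) auto
      then show ?case using card[of n] elim by simp
    qed
  qed
  ultimately show ?thesis by simp
qed

lemma sum_UN_le:
  fixes f :: "'b \<Rightarrow> ennreal"
  assumes "finite I" "\<And>i. i \<in> I \<Longrightarrow> finite (B i)"
  shows "sum f (\<Union>i\<in>I. B i) \<le> (\<Sum>i\<in>I. sum f (B i))"
  using assms
proof (induction I rule: finite_induct)
  case (insert i I)
  have "sum f (\<Union>j\<in>insert i I. B j) \<le> sum f (B i \<union> (\<Union>j\<in>I. B j)) + sum f (B i \<inter> (\<Union>j\<in>I. B j))"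
    by simp
  also have "\<dots> = sum f (B i) + sum f (\<Union>j\<in>I. B j)"
    using insert by (intro sum.union_inter) auto
  also have "\<dots> \<le> sum f (B i) + (\<Sum>j\<in>I. sum f (B j))"
    using insert by (intro add_left_mono) auto
  finally show ?case using insert by simp
qed simp

section \<open>Aggregation with transition probabilities of order 1/sqrt n\<close>

text \<open>Abstracts from the ballistic measure what the probabilistic argument uses: its support
  (\<open>\<nu>_eq_0\<close>) and a bound uniform in the added point
  (\<open>\<nu>_le\<close>).\<close>

locale aggregation_process = prob_space M for M :: "'w measure" +
  fixes \<nu> :: "(int ^ 'd::finite) set \<Rightarrow> int ^ 'd \<Rightarrow> real"
    and F :: "nat \<Rightarrow> 'w \<Rightarrow> (int ^ 'd) set"
    and y :: "nat \<Rightarrow> 'w \<Rightarrow> int ^ 'd"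
    and C :: real
  assumes F_measurable: "1 \<le> n \<Longrightarrow> F n \<in> measurable M (count_space {A. finite A})"
    and y_measurable: "1 \<le> n \<Longrightarrow> y n \<in> measurable M (count_space UNIV)"
    and F_1: "\<omega> \<in> space M \<Longrightarrow> F 1 \<omega> = {0}"
    and F_Suc: "1 \<le> n \<Longrightarrow> \<omega> \<in> space M \<Longrightarrow> F (n + 1) \<omega> = F n \<omega> \<union> {y (n + 1) \<omega>}"
    and transition: "1 \<le> n \<Longrightarrow> \<P>(\<omega> in M. \<forall>k\<in>{1..n}. F k \<omega> = h k) > 0 \<Longrightarrow>
        \<P>(\<omega> in M. y (n + 1) \<omega> = z \<bar> \<forall>k\<in>{1..n}. F k \<omega> = h k) = \<nu> (outer_boundary (h n)) z"
    and \<nu>_eq_0: "z \<notin> B \<Longrightarrow> \<nu> B z = 0"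
    and C_pos: "0 < C"
    and \<nu>_le: "finite A \<Longrightarrow> A \<noteq> {} \<Longrightarrow> \<nu> (outer_boundary A) z \<le> C / sqrt (card A)"
begin

lemma F_finite: "1 \<le> n \<Longrightarrow> \<omega> \<in> space M \<Longrightarrow> finite (F n \<omega>)"
  using measurable_space[OF F_measurable] by auto

lemma F_nonempty: "1 \<le> n \<Longrightarrow> \<omega> \<in> space M \<Longrightarrow> F n \<omega> \<noteq> {}"
proof (induction n rule: dec_induct)
  case base
  then show ?case using F_1 by simp
next
  case (step n)
  then show ?case using F_Suc[of n \<omega>] by simp
qed

lemma sets_F: "1 \<le> n \<Longrightarrow> {\<omega> \<in> space M. F n \<omega> = A} \<in> sets M"
proof -
  assume n: "1 \<le> n"
  show ?thesis
  proof (cases "finite A")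
    case True
    have "F n -` {A} \<inter> space M \<in> sets M"
      using True by (intro measurable_sets[OF F_measurable[OF n]]) simp
    moreover have "F n -` {A} \<inter> space M = {\<omega> \<in> space M. F n \<omega> = A}" by auto
    ultimately show ?thesis by simp
  next
    case False
    then have "{\<omega> \<in> space M. F n \<omega> = A} = {}" using F_finite[OF n] by auto
    then show ?thesis by (simp only: sets.empty_sets)
  qed
qed

lemma sets_y: "1 \<le> n \<Longrightarrow> {\<omega> \<in> space M. y n \<omega> = z} \<in> sets M"
  using measurable_sets[OF y_measurable, of n "{z}"] by (simp add: vimage_def Int_def conj_commute)

text \<open>The assumption \<open>transition\<close> conditions on whole histories; here only the
  present set \<open>A\<close> matters, which may also have probability 0.\<close>

lemma emeasure_transition_le:
  assumes n: "1 \<le> n"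
  shows "emeasure M {\<omega> \<in> space M. F n \<omega> = A \<and> y (n + 1) \<omega> = z}
    \<le> ennreal (\<nu> (outer_boundary A) z) * emeasure M {\<omega> \<in> space M. F n \<omega> = A}"
proof -
  \<comment> \<open>sum over the countably many histories that end in \<open>A\<close>\<close>
  define I where "I = {h \<in> PiE {1..n} (\<lambda>_. {B :: (int ^ 'd) set. finite B}). h n = A}"
  define E where "E h = {\<omega> \<in> space M. \<forall>k\<in>{1..n}. F k \<omega> = h k}" for h
  define Y where "Y = {\<omega> \<in> space M. y (n + 1) \<omega> = z}"
  have Y: "Y \<in> sets M" unfolding Y_def by (rule sets_y) simp
  have "countable (PiE {1..n} (\<lambda>_. {B :: (int ^ 'd) set. finite B}))"
    by (intro countable_PiE countable_Collect_finite) simp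
  then have cI: "countable I" unfolding I_def by (rule countable_subset[rotated]) auto
  have E: "E h \<in> sets M" for h
  proof -
    have "E h = space M \<inter> (\<Inter>k\<in>{1..n}. {\<omega> \<in> space M. F k \<omega> = h k})" by (auto simp: E_def)
    also have "\<dots> \<in> sets M" using n sets_F by (intro sets.Int sets.top sets.finite_INT) auto
    finally show ?thesis .
  qed
  \<comment> \<open>Extensional functions that differ do so at some time in \<open>{1..n}\<close>,
    hence distinct histories are incompatible.\<close>
  have disj: "disjoint_family_on E I"
    unfolding disjoint_family_on_def
  proof (intro ballI impI)
    fix g h assume gh: "g \<in> I" "h \<in> I" "g \<noteq> h"
    then have "\<exists>k\<in>{1..n}. g k \<noteq> h k"
      unfolding I_def by (metis (no_types, lifting) PiE_ext mem_Collect_eq)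
    then show "E g \<inter> E h = {}" by (auto simp: E_def)
  qed
  have un: "{\<omega> \<in> space M. F n \<omega> = A} = (\<Union>h\<in>I. E h)"
  proof (intro set_eqI iffI)
    fix \<omega> assume w: "\<omega> \<in> {\<omega> \<in> space M. F n \<omega> = A}"
    then have "restrict (\<lambda>k. F k \<omega>) {1..n} \<in> I" using n F_finite by (auto simp: I_def)
    moreover have "\<omega> \<in> E (restrict (\<lambda>k. F k \<omega>) {1..n})" using w by (simp add: E_def)
    ultimately show "\<omega> \<in> (\<Union>h\<in>I. E h)" by blast
  next
    fix \<omega> assume "\<omega> \<in> (\<Union>h\<in>I. E h)"
    then show "\<omega> \<in> {\<omega> \<in> space M. F n \<omega> = A}" using n by (auto simp: E_def I_def)
  qed
  have le: "emeasure M (E h \<inter> Y) \<le> ennreal (\<nu> (outer_boundary A) z) * emeasure M (E h)" if h: "h \<in> I" for h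
  \<comment> \<open>A null history determines no value of \<open>\<nu>\<close>, but both sides
    vanish.\<close>
  proof (cases "prob (E h) = 0")
    case True
    have "emeasure M (E h \<inter> Y) \<le> emeasure M (E h)" using E by (intro emeasure_mono) auto
    then show ?thesis using True by (simp add: emeasure_eq_measure)
  next
    case False
    then have pos: "0 < prob (E h)" using measure_nonneg[of M "E h"] by linarith
    have "\<P>(\<omega> in M. y (n + 1) \<omega> = z \<bar> \<forall>k\<in>{1..n}. F k \<omega> = h k) = \<nu> (outer_boundary A) z"
      using transition[OF n, of h z] pos h by (simp add: E_def I_def)
    moreover have "{\<omega> \<in> space M. y (n + 1) \<omega> = z \<and> (\<forall>k\<in>{1..n}. F k \<omega> = h k)} = E h \<inter> Y"
      by (auto simp: E_def Y_def)
    ultimately have "prob (E h \<inter> Y) / prob (E h) = \<nu> (outer_boundary A) z"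
      by (simp add: cond_prob_def E_def)
    then have "prob (E h \<inter> Y) = \<nu> (outer_boundary A) z * prob (E h)" using pos by (simp add: field_simps)
    then show ?thesis by (simp add: emeasure_eq_measure ennreal_mult'')
  qed
  have "{\<omega> \<in> space M. F n \<omega> = A \<and> y (n + 1) \<omega> = z} = (\<Union>h\<in>I. E h \<inter> Y)"
    using un by (auto simp: Y_def)
  also have "emeasure M \<dots> = (\<integral>\<^sup>+h. emeasure M (E h \<inter> Y) \<partial>count_space I)"
    using E Y cI disj by (intro emeasure_UN_countable) (auto simp: disjoint_family_on_def)
  also have "\<dots> \<le> (\<integral>\<^sup>+h. ennreal (\<nu> (outer_boundary A) z) * emeasure M (E h) \<partial>count_space I)"
    by (intro nn_integral_mono le) simp
  also have "\<dots> = ennreal (\<nu> (outer_boundary A) z) * (\<integral>\<^sup>+h. emeasure M (E h) \<partial>count_space I)"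
    by (rule nn_integral_cmult) simp
  also have "(\<integral>\<^sup>+h. emeasure M (E h) \<partial>count_space I) = emeasure M {\<omega> \<in> space M. F n \<omega> = A}"
    unfolding un using E cI disj by (intro emeasure_UN_countable[symmetric]) auto
  finally show ?thesis .
qed

text \<open>There are countably many pairs \<open>(A, z)\<close> with \<open>A\<close> finite, and
  each pair with \<open>z\<close> outside the outer boundary of \<open>A\<close> has probability
  0.\<close>

lemma AE_y_in_outer_boundary:
  assumes n: "1 \<le> n"
  shows "AE \<omega> in M. y (n + 1) \<omega> \<in> outer_boundary (F n \<omega>)"
proof -
  have "AE \<omega> in M. F n \<omega> = A \<and> y (n + 1) \<omega> = z \<longrightarrow> z \<in> outer_boundary A" for A z
  proof (cases "z \<in> outer_boundary A")
    case False
    have "{\<omega> \<in> space M. F n \<omega> = A \<and> y (n + 1) \<omega> = z} = {\<omega> \<in> space M. F n \<omega> = A} \<inter> {\<omega> \<in> space M. y (n + 1) \<omega> = z}"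
      by auto
    then have "{\<omega> \<in> space M. F n \<omega> = A \<and> y (n + 1) \<omega> = z} \<in> null_sets M"
      using emeasure_transition_le[OF n, of A z] \<nu>_eq_0[OF False] sets_F[OF n, of A] sets_y[of "n + 1" z]
      by (auto simp: null_sets_def)
    then show ?thesis using False by (intro AE_I'[of _ M]) auto
  qed simp
  then have "AE \<omega> in M. \<forall>A\<in>{A. finite A}. \<forall>z. F n \<omega> = A \<and> y (n + 1) \<omega> = z \<longrightarrow> z \<in> outer_boundary A"
    by (simp only: AE_ball_countable[OF countable_Collect_finite] AE_all_countable) blast
  then show ?thesis
    using AE_space by eventually_elim (use F_finite[OF n] in auto)
qed

text \<open>A point of the outer boundary of \<open>F n\<close> is not in \<open>F n\<close>, so
  almost surely each step adds a new point.\<close>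

lemma AE_card_F: "AE \<omega> in M. \<forall>n\<ge>1. card (F n \<omega>) = n"
proof -
  have "AE \<omega> in M. \<forall>n. 1 \<le> n \<longrightarrow> y (n + 1) \<omega> \<in> outer_boundary (F n \<omega>)"
    unfolding AE_all_countable using AE_y_in_outer_boundary by (auto simp del: One_nat_def)
  then show ?thesis using AE_space
  proof eventually_elim
    case (elim \<omega>)
    have "card (F n \<omega>) = n" if "1 \<le> n" for n
      using that
    proof (induction n rule: dec_induct)
      case base
      then show ?case using F_1 elim by simp
    next
      case (step n)
      have "y (n + 1) \<omega> \<notin> F n \<omega>" using elim step(1) by (auto simp: outer_boundary_def)
      then show ?case using F_Suc[OF step(1) elim(2)] F_finite[OF step(1) elim(2)] step by simp
    qed
    then show ?case by blast
  qed
qed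

text \<open>Moving to a neighbour multiplies this weight by at most \<open>exp 1\<close>, while a
  single far point makes the sum over \<open>F n\<close> exponentially large. Values in
  \<open>ennreal\<close> avoid integrability questions.\<close>

definition exp_norm :: "int ^ 'd \<Rightarrow> ennreal" where "exp_norm x = ennreal (exp (norm (real_point x)))"

text \<open>Growth constant: the transition bound, times the weight factor between neighbours, times
  a crude bound on the number of neighbours.\<close>

definition \<kappa> :: real where
  "\<kappa> = C * exp 1 * real (card {w :: int ^ 'd. norm (real_point w) \<le> 1 + real CARD('d)})"

lemma \<kappa>_nonneg: "0 \<le> \<kappa>" using C_pos by (simp add: \<kappa>_def)

text \<open>Every boundary point is within distance 1 of a point of \<open>A\<close>; charging its
  weight to that point costs a factor \<open>exp 1\<close>, and each point is charged a bounded
  number of times.\<close>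

lemma sum_exp_norm_outer_boundary_le:
  assumes "finite A"
  shows "ennreal C * sum exp_norm (outer_boundary A) \<le> ennreal \<kappa> * sum exp_norm A"
proof -
  define N where "N = card {w :: int ^ 'd. norm (real_point w) \<le> 1 + real CARD('d)}"
  let ?B = "\<lambda>x. {w :: int ^ 'd. norm (real_point w - real_point x) \<le> 1}"
  have "sum exp_norm (outer_boundary A) \<le> sum exp_norm (\<Union>x\<in>A. ?B x)"
    by (intro sum_mono2 finite_UN_I assms lattice_ball_translate) (auto simp: outer_boundary_def neighbours_def)
  also have "\<dots> \<le> (\<Sum>x\<in>A. sum exp_norm (?B x))"
    using assms lattice_ball_translate(1) by (intro sum_UN_le) auto
  also have "\<dots> \<le> (\<Sum>x\<in>A. ennreal (exp 1 * real N) * exp_norm x)"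
  proof (rule sum_mono)
    fix x assume "x \<in> A"
    have "sum exp_norm (?B x) \<le> of_nat (card (?B x)) * ennreal (exp 1 * exp (norm (real_point x)))"
    proof (rule sum_bounded_above)
      fix w assume "w \<in> ?B x"
      then have "norm (real_point w) \<le> 1 + norm (real_point x)"
        using norm_triangle_ineq[of "real_point w - real_point x" "real_point x"] by simp
      then have "exp (norm (real_point w)) \<le> exp 1 * exp (norm (real_point x))" by (simp flip: exp_add)
      then show "exp_norm w \<le> ennreal (exp 1 * exp (norm (real_point x)))" unfolding exp_norm_def by (rule ennreal_leI)
    qed
    also have "\<dots> \<le> of_nat N * ennreal (exp 1 * exp (norm (real_point x)))"
      unfolding N_def by (intro mult_right_mono of_nat_mono lattice_ball_translate) auto
    also have "\<dots> = ennreal (exp 1 * real N) * exp_norm x"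
      by (simp add: exp_norm_def ennreal_of_nat_eq_real_of_nat mult_ac flip: ennreal_mult)
    finally show "sum exp_norm (?B x) \<le> ennreal (exp 1 * real N) * exp_norm x" .
  qed
  also have "\<dots> = ennreal (exp 1 * real N) * sum exp_norm A" by (simp add: sum_distrib_left)
  finally have "ennreal C * sum exp_norm (outer_boundary A) \<le> ennreal C * (ennreal (exp 1 * real N) * sum exp_norm A)"
    by (intro mult_left_mono) auto
  also have "\<dots> = ennreal \<kappa> * sum exp_norm A"
    using C_pos by (simp add: \<kappa>_def N_def ennreal_mult mult_ac)
  finally show ?thesis .
qed

text \<open>Given \<open>F n = A\<close> with \<open>card A = n\<close>, each boundary point is
  added with probability at most \<open>C / sqrt n\<close>; the sum of weights over the boundary is
  then compared with the sum over \<open>A\<close>.\<close>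

lemma nn_integral_exp_norm_y_le:
  assumes n: "1 \<le> n"
  shows "(\<integral>\<^sup>+\<omega>. exp_norm (y (n + 1) \<omega>) \<partial>M) \<le> ennreal (\<kappa> / sqrt n) * (\<integral>\<^sup>+\<omega>. sum exp_norm (F n \<omega>) \<partial>M)"
proof -
  let ?X = "{A :: (int ^ 'd) set. finite A}"
  have cX: "countable ?X" by (rule countable_Collect_finite)
  have [measurable]: "(\<lambda>\<omega>. exp_norm (y (n + 1) \<omega>)) \<in> borel_measurable M"
    by (rule measurable_compose[OF y_measurable]) simp_all
  have [measurable]: "(\<lambda>\<omega>. f (F n \<omega>)) \<in> borel_measurable M" for f :: "_ \<Rightarrow> ennreal"
    by (rule measurable_compose[OF F_measurable[OF n]]) simp
  \<comment> \<open>Splits an expectation according to the countably many values \<open>A\<close> of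
    \<open>F n\<close>: for each \<open>\<omega>\<close> exactly one indicator is nonzero.\<close>
  have split: "(\<integral>\<^sup>+\<omega>. u \<omega> \<partial>M) = (\<integral>\<^sup>+A. (\<integral>\<^sup>+\<omega>. u \<omega> * indicator {A} (F n \<omega>) \<partial>M) \<partial>count_space ?X)"
    if [measurable]: "u \<in> borel_measurable M" for u
  proof -
    have "u \<omega> = (\<integral>\<^sup>+A. u \<omega> * indicator {A} (F n \<omega>) \<partial>count_space ?X)" if "\<omega> \<in> space M" for \<omega>
    proof -
      have "(\<integral>\<^sup>+A. u \<omega> * indicator {A} (F n \<omega>) \<partial>count_space ?X) = (\<integral>\<^sup>+A. u \<omega> * indicator {F n \<omega>} A \<partial>count_space ?X)"
        by (intro nn_integral_cong) (auto simp: indicator_def)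
      also have "\<dots> = u \<omega> * emeasure (count_space ?X) {F n \<omega>}"
        using F_finite[OF n that] by (intro nn_integral_cmult_indicator) simp
      also have "\<dots> = u \<omega>" using F_finite[OF n that] by (subst emeasure_count_space_finite) auto
      finally show ?thesis by simp
    qed
    then have "(\<integral>\<^sup>+\<omega>. u \<omega> \<partial>M) = (\<integral>\<^sup>+\<omega>. (\<integral>\<^sup>+A. u \<omega> * indicator {A} (F n \<omega>) \<partial>count_space ?X) \<partial>M)"
      by (intro nn_integral_cong)
    also have "\<dots> = (\<integral>\<^sup>+A. (\<integral>\<^sup>+\<omega>. u \<omega> * indicator {A} (F n \<omega>) \<partial>M) \<partial>count_space ?X)"
      by (rule nn_integral_count_space_nn_integral[OF cX]) measurable
    finally show ?thesis .
  qed
  have le: "(\<integral>\<^sup>+\<omega>. exp_norm (y (n + 1) \<omega>) * indicator {A} (F n \<omega>) \<partial>M)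
      \<le> (\<integral>\<^sup>+\<omega>. (ennreal (\<kappa> / sqrt n) * sum exp_norm (F n \<omega>)) * indicator {A} (F n \<omega>) \<partial>M)" if A: "finite A" for A
  \<comment> \<open>Sets of another cardinality are attained with probability 0, so there both
    integrands vanish almost everywhere.\<close>
  proof (cases "card A = n")
    case False
    have "AE \<omega> in M. exp_norm (y (n + 1) \<omega>) * indicator {A} (F n \<omega>) \<le> (ennreal (\<kappa> / sqrt n) * sum exp_norm (F n \<omega>)) * indicator {A} (F n \<omega>)"
      using AE_card_F by eventually_elim (use False n in \<open>auto simp: indicator_def\<close>)
    then show ?thesis by (rule nn_integral_mono_AE)
  next
    case True
    then have ne: "A \<noteq> {}" using n by auto
    define P where "P = emeasure M {\<omega> \<in> space M. F n \<omega> = A}"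
    let ?Q = "\<lambda>z. {\<omega> \<in> space M. F n \<omega> = A \<and> y (n + 1) \<omega> = z}"
    have Q: "?Q z \<in> sets M" for z
    proof -
      have "?Q z = {\<omega> \<in> space M. F n \<omega> = A} \<inter> {\<omega> \<in> space M. y (n + 1) \<omega> = z}" by auto
      then show ?thesis using sets_F[OF n, of A] sets_y[of "n + 1" z] by auto
    qed
    have finb: "finite (outer_boundary A)" by (rule finite_outer_boundary[OF A])
    have "(\<integral>\<^sup>+\<omega>. exp_norm (y (n + 1) \<omega>) * indicator {A} (F n \<omega>) \<partial>M)
       \<le> (\<integral>\<^sup>+\<omega>. (\<Sum>z\<in>outer_boundary A. exp_norm z * indicator (?Q z) \<omega>) \<partial>M)"
    proof (rule nn_integral_mono_AE)
      \<comment> \<open>If \<open>F n \<omega> = A\<close>, the new point almost surely lies in the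
        boundary of \<open>A\<close>, so the left side is one of the summands.\<close>
      show "AE \<omega> in M. exp_norm (y (n + 1) \<omega>) * indicator {A} (F n \<omega>) \<le> (\<Sum>z\<in>outer_boundary A. exp_norm z * indicator (?Q z) \<omega>)"
        using AE_y_in_outer_boundary[OF n] AE_space
      proof eventually_elim
        case (elim \<omega>)
        show ?case
        proof (cases "F n \<omega> = A")
          case True
          have "exp_norm (y (n + 1) \<omega>) * indicator (?Q (y (n + 1) \<omega>)) \<omega> \<le> (\<Sum>z\<in>outer_boundary A. exp_norm z * indicator (?Q z) \<omega>)"
            using elim True by (intro member_le_sum finb) auto
          then show ?thesis using True elim by (simp add: indicator_def)
        qed simp
      qed
    qed
    also have "\<dots> = (\<Sum>z\<in>outer_boundary A. exp_norm z * emeasure M (?Q z))"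
      using Q by (subst nn_integral_sum) (auto intro!: sum.cong nn_integral_cmult_indicator)
    also have "\<dots> \<le> (\<Sum>z\<in>outer_boundary A. exp_norm z * (ennreal (C / sqrt n) * P))"
    proof (intro sum_mono mult_left_mono)
      fix z
      have "emeasure M (?Q z) \<le> ennreal (\<nu> (outer_boundary A) z) * P"
        unfolding P_def by (rule emeasure_transition_le[OF n])
      also have "\<dots> \<le> ennreal (C / sqrt n) * P"
        using \<nu>_le[OF A ne, of z] True by (intro mult_right_mono ennreal_leI) auto
      finally show "emeasure M (?Q z) \<le> ennreal (C / sqrt n) * P" .
    qed simp
    also have "\<dots> = ennreal (1 / sqrt n) * P * (ennreal C * sum exp_norm (outer_boundary A))"
      using C_pos by (simp add: sum_distrib_right sum_distrib_left mult_ac divide_inverse ennreal_mult)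
    also have "\<dots> \<le> ennreal (1 / sqrt n) * P * (ennreal \<kappa> * sum exp_norm A)"
      by (intro mult_left_mono sum_exp_norm_outer_boundary_le A) simp
    also have "\<dots> = (ennreal (\<kappa> / sqrt n) * sum exp_norm A) * P"
      using \<kappa>_nonneg by (simp add: mult_ac divide_inverse ennreal_mult)
    also have "\<dots> = (\<integral>\<^sup>+\<omega>. (ennreal (\<kappa> / sqrt n) * sum exp_norm A) * indicator {\<omega> \<in> space M. F n \<omega> = A} \<omega> \<partial>M)"
      unfolding P_def by (rule nn_integral_cmult_indicator[symmetric]) (rule sets_F[OF n])
    also have "\<dots> = (\<integral>\<^sup>+\<omega>. (ennreal (\<kappa> / sqrt n) * sum exp_norm (F n \<omega>)) * indicator {A} (F n \<omega>) \<partial>M)"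
      by (intro nn_integral_cong) (auto simp: indicator_def)
    finally show ?thesis .
  qed
  have "(\<integral>\<^sup>+\<omega>. exp_norm (y (n + 1) \<omega>) \<partial>M) = (\<integral>\<^sup>+A. (\<integral>\<^sup>+\<omega>. exp_norm (y (n + 1) \<omega>) * indicator {A} (F n \<omega>) \<partial>M) \<partial>count_space ?X)"
    by (rule split) measurable
  also have "\<dots> \<le> (\<integral>\<^sup>+A. (\<integral>\<^sup>+\<omega>. (ennreal (\<kappa> / sqrt n) * sum exp_norm (F n \<omega>)) * indicator {A} (F n \<omega>) \<partial>M) \<partial>count_space ?X)"
    by (intro nn_integral_mono le) simp
  also have "\<dots> = (\<integral>\<^sup>+\<omega>. ennreal (\<kappa> / sqrt n) * sum exp_norm (F n \<omega>) \<partial>M)"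
    by (rule split[symmetric]) measurable
  also have "\<dots> = ennreal (\<kappa> / sqrt n) * (\<integral>\<^sup>+\<omega>. sum exp_norm (F n \<omega>) \<partial>M)"
    by (rule nn_integral_cmult) measurable
  finally show ?thesis .
qed

lemma sum_exp_norm_F_measurable: "1 \<le> n \<Longrightarrow> (\<lambda>\<omega>. sum exp_norm (F n \<omega>)) \<in> borel_measurable M"
  by (rule measurable_compose[OF F_measurable]) simp_all

text \<open>By \<open>1 + x \<le> exp x\<close> the factors \<open>1 + \<kappa> / sqrt n\<close> are
  dominated by telescoping exponentials; the constant 4 comes from
  \<open>1 / sqrt n \<le> 4 * (sqrt (n + 1) - sqrt n)\<close>.\<close>

lemma nn_integral_sum_exp_norm_F_le:
  "1 \<le> n \<Longrightarrow> (\<integral>\<^sup>+\<omega>. sum exp_norm (F n \<omega>) \<partial>M) \<le> ennreal (exp (4 * \<kappa> * sqrt n))"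
proof (induction n rule: dec_induct)
  case base
  have "(\<integral>\<^sup>+\<omega>. sum exp_norm (F 1 \<omega>) \<partial>M) = (\<integral>\<^sup>+\<omega>. 1 \<partial>M)"
    by (intro nn_integral_cong) (simp add: F_1[unfolded One_nat_def] exp_norm_def real_point_def zero_vec_def[symmetric])
  also have "\<dots> = ennreal 1" by (simp add: emeasure_space_1)
  also have "\<dots> \<le> ennreal (exp (4 * \<kappa> * sqrt (real 1)))" using \<kappa>_nonneg by (intro ennreal_leI) simp
  finally show ?case .
next
  case (step n)
  have n: "1 \<le> n" by fact
  have "(\<integral>\<^sup>+\<omega>. sum exp_norm (F (Suc n) \<omega>) \<partial>M) \<le> (\<integral>\<^sup>+\<omega>. sum exp_norm (F n \<omega>) + exp_norm (y (n + 1) \<omega>) \<partial>M)"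
  proof (rule nn_integral_mono)
    fix \<omega> assume w: "\<omega> \<in> space M"
    \<comment> \<open>Only an inequality, as the sum does not change if the point is already in
      \<open>F n\<close>.\<close>
    show "sum exp_norm (F (Suc n) \<omega>) \<le> sum exp_norm (F n \<omega>) + exp_norm (y (n + 1) \<omega>)"
      using F_Suc[OF n w] F_finite[OF n w] by (cases "y (n + 1) \<omega> \<in> F n \<omega>") (auto simp: insert_absorb add.commute)
  qed
  also have "\<dots> = (\<integral>\<^sup>+\<omega>. sum exp_norm (F n \<omega>) \<partial>M) + (\<integral>\<^sup>+\<omega>. exp_norm (y (n + 1) \<omega>) \<partial>M)"
    using sum_exp_norm_F_measurable[OF n] measurable_compose[OF y_measurable[of "n + 1"], of exp_norm borel]
    by (intro nn_integral_add) auto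
  also have "\<dots> \<le> (\<integral>\<^sup>+\<omega>. sum exp_norm (F n \<omega>) \<partial>M) + ennreal (\<kappa> / sqrt n) * (\<integral>\<^sup>+\<omega>. sum exp_norm (F n \<omega>) \<partial>M)"
    by (intro add_left_mono nn_integral_exp_norm_y_le[OF n])
  also have "\<dots> = ennreal (1 + \<kappa> / sqrt n) * (\<integral>\<^sup>+\<omega>. sum exp_norm (F n \<omega>) \<partial>M)"
    using \<kappa>_nonneg by (simp add: ennreal_plus distrib_right)
  also have "\<dots> \<le> ennreal (1 + \<kappa> / sqrt n) * ennreal (exp (4 * \<kappa> * sqrt n))"
    by (intro mult_left_mono step.IH) simp
  also have "\<dots> = ennreal ((1 + \<kappa> / sqrt n) * exp (4 * \<kappa> * sqrt n))"
    using \<kappa>_nonneg by (intro ennreal_mult[symmetric]) auto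
  also have "\<dots> \<le> ennreal (exp (4 * \<kappa> * sqrt (Suc n)))"
  proof (rule ennreal_leI)
    have s: "1 \<le> sqrt n" using n by simp
    \<comment> \<open>This crude comparison bounds the denominator in
      \<open>sqrt (n + 1) - sqrt n = 1 / (sqrt (n + 1) + sqrt n)\<close> by
      \<open>4 * sqrt n\<close>.\<close>
    have "sqrt (real (Suc n)) \<le> sqrt (9 * real n)" using n by (intro real_sqrt_le_mono) simp
    also have "\<dots> = 3 * sqrt n" by (simp add: real_sqrt_mult)
    finally have s3: "sqrt (Suc n) + sqrt n \<le> 4 * sqrt n" by simp
    have prod: "(sqrt (Suc n) - sqrt n) * (sqrt (Suc n) + sqrt n) = 1"
      by (simp add: algebra_simps flip: power2_eq_square)
    have pos: "0 < sqrt (Suc n) + sqrt n" using s real_sqrt_ge_zero[of "real (Suc n)"] by linarith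
    from nonzero_eq_divide_eq[THEN iffD2, OF less_imp_neq[OF pos, symmetric] prod]
    have "sqrt (Suc n) - sqrt n = 1 / (sqrt (Suc n) + sqrt n)" .
    also have "\<dots> \<ge> 1 / (4 * sqrt n)" using s by (intro divide_left_mono[OF s3] mult_pos_pos pos) auto
    finally have d: "1 / sqrt n \<le> 4 * (sqrt (Suc n) - sqrt n)" by simp
    have "\<kappa> / sqrt n \<le> \<kappa> * (4 * (sqrt (Suc n) - sqrt n))"
      using mult_left_mono[OF d \<kappa>_nonneg] by simp
    then have "exp (\<kappa> / sqrt n) \<le> exp (\<kappa> * (4 * (sqrt (Suc n) - sqrt n)))" by simp
    with exp_ge_add_one_self[of "\<kappa> / sqrt n"]
    have "1 + \<kappa> / sqrt n \<le> exp (\<kappa> * (4 * (sqrt (Suc n) - sqrt n)))" by (rule order_trans)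
    then have "(1 + \<kappa> / sqrt n) * exp (4 * \<kappa> * sqrt n) \<le> exp (\<kappa> * (4 * (sqrt (Suc n) - sqrt n))) * exp (4 * \<kappa> * sqrt n)"
      by (intro mult_right_mono) auto
    also have "\<dots> = exp (4 * \<kappa> * sqrt (Suc n))" by (simp add: algebra_simps flip: exp_add)
    finally show "(1 + \<kappa> / sqrt n) * exp (4 * \<kappa> * sqrt n) \<le> exp (4 * \<kappa> * sqrt (Suc n))" .
  qed
  finally show ?case .
qed

section \<open>Borel-Cantelli argument for the radius\<close>

text \<open>A point of norm \<open>\<rho>\<close> forces the sum of weights to be at least
  \<open>exp \<rho>\<close>. The extra 1 in \<open>4 * \<kappa> + 1\<close> leaves the factor
  \<open>exp (- sqrt n)\<close> in Markov's inequality.\<close>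

lemma AE_eventually_rad_le:
  "AE \<omega> in M. eventually (\<lambda>n. rad (F n \<omega>) \<le> (4 * \<kappa> + 1) * sqrt n) sequentially"
proof -
  \<comment> \<open>Indexed by \<open>Suc n\<close> because the process starts at time 1; the shift
    is undone at the end.\<close>
  define B where "B n = {\<omega> \<in> space M. ennreal (exp ((4 * \<kappa> + 1) * sqrt (Suc n))) \<le> sum exp_norm (F (Suc n) \<omega>)}" for n
  have B: "B n \<in> sets M" for n
    unfolding B_def using sum_exp_norm_F_measurable[of "Suc n"] by measurable
  have "prob (B n) \<le> exp (- sqrt (Suc n))" for n
  proof -
    let ?a = "exp ((4 * \<kappa> + 1) * sqrt (Suc n))"
    \<comment> \<open>Markov's inequality, written with the indicator of \<open>B n\<close>.\<close>
    have "emeasure M (B n) * ennreal ?a = (\<integral>\<^sup>+\<omega>. ennreal ?a * indicator (B n) \<omega> \<partial>M)"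
      using B[of n] by (subst nn_integral_cmult_indicator) (simp_all only: mult.commute)
    also have "\<dots> \<le> (\<integral>\<^sup>+\<omega>. sum exp_norm (F (Suc n) \<omega>) \<partial>M)"
      by (intro nn_integral_mono) (auto simp: B_def indicator_def)
    also have "\<dots> \<le> ennreal (exp (4 * \<kappa> * sqrt (Suc n)))" by (rule nn_integral_sum_exp_norm_F_le) simp
    finally have "prob (B n) * ?a \<le> exp (4 * \<kappa> * sqrt (Suc n))"
      by (simp add: emeasure_eq_measure flip: ennreal_mult)
    then have "prob (B n) * ?a * exp (- ((4 * \<kappa> + 1) * sqrt (Suc n)))
        \<le> exp (4 * \<kappa> * sqrt (Suc n)) * exp (- ((4 * \<kappa> + 1) * sqrt (Suc n)))"
      by (intro mult_right_mono) auto
    then show ?thesis by (simp add: mult.assoc algebra_simps flip: exp_add)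
  qed
  then have "summable (\<lambda>n. prob (B n))"
    by (intro summable_comparison_test[OF _ summable_exp_minus_sqrt]) auto
  then have "AE \<omega> in M. eventually (\<lambda>n. \<omega> \<in> space M - B n) sequentially"
    using B by (intro borel_cantelli_AE1) (auto simp: emeasure_eq_measure)
  then show ?thesis
  proof eventually_elim
    case (elim \<omega>)
    then have "eventually (\<lambda>n. rad (F (Suc n) \<omega>) \<le> (4 * \<kappa> + 1) * sqrt (Suc n)) sequentially"
    proof eventually_elim
      case (elim n)
      then have w: "\<omega> \<in> space M" by simp
      have fin: "finite (F (Suc n) \<omega>)" "F (Suc n) \<omega> \<noteq> {}"
        using F_finite[OF _ w, of "Suc n"] F_nonempty[OF _ w, of "Suc n"] by auto
      have "norm (real_point x) \<le> (4 * \<kappa> + 1) * sqrt (Suc n)" if x: "x \<in> F (Suc n) \<omega>" for x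
      proof -
        have "exp_norm x \<le> sum exp_norm (F (Suc n) \<omega>)" using x fin by (intro member_le_sum) auto
        also have "\<dots> < ennreal (exp ((4 * \<kappa> + 1) * sqrt (Suc n)))" using elim by (auto simp: B_def not_le)
        finally show ?thesis by (simp add: exp_norm_def ennreal_less_iff)
      qed
      then show ?case unfolding rad_def using fin by (subst Max_le_iff) auto
    qed
    then show ?case by (subst (asm) eventually_sequentially_Suc)
  qed
qed

lemma AE_lower_fractal_dimension_ge_2: "AE \<omega> in M. 2 \<le> lower_fractal_dimension (\<lambda>n. F n \<omega>)"
  using AE_card_F AE_eventually_rad_le AE_space
proof eventually_elim
  case (elim \<omega>)
  show ?case
    by (rule lower_fractal_dimension_ge_2I[where K = "4 * \<kappa> + 1"])
       (use elim F_finite \<kappa>_nonneg in auto)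
qed

end

theorem corollary5p5:
  fixes \<mu> :: "(real, 'd::{finite,linorder}) vec set measure"
    and v :: "(real, 'd) vec set \<Rightarrow> (real, 'd) vec"
    and M :: "'w measure"
    and F :: "nat \<Rightarrow> 'w \<Rightarrow> (int, 'd) vec set"
  assumes "CARD('d) \<ge> 3"
    and "invariant_line_measure \<mu>"
    and "line_direction v"
    and "ballistic_aggregation \<mu> v M F"
  shows "AE \<omega> in M. lower_fractal_dimension (\<lambda>n. F n \<omega>) \<ge> 2"
proof -
  obtain C where C: "0 < C" "\<And>A z. finite A \<Longrightarrow> A \<noteq> {} \<Longrightarrow>
      ballistic_measure \<mu> v (outer_boundary A) z \<le> C / sqrt (card A)"
    using ballistic_measure_outer_boundary_le[OF assms(2), of v] assms(1) by auto
  have agg: "incremental_aggregation (ballistic_measure \<mu> v) M F"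
    using assms(4) by (simp only: ballistic_aggregation_def)
  then interpret prob_space M by (simp add: incremental_aggregation_def)
  from agg obtain y where
    "\<forall>n\<ge>1. F n \<in> measurable M (count_space {A. finite A})"
    "\<forall>n\<ge>1. y n \<in> measurable M (count_space UNIV)"
    "\<forall>\<omega>\<in>space M. y 1 \<omega> = 0 \<and> F 1 \<omega> = {y 1 \<omega>}"
    "\<forall>n\<ge>1. \<forall>\<omega>\<in>space M. F (n + 1) \<omega> = F n \<omega> \<union> {y (n + 1) \<omega>}"
    "\<forall>n\<ge>1. \<forall>A z. \<P>(\<omega> in M. \<forall>k\<in>{1..n}. F k \<omega> = A k) > 0 \<longrightarrow>
       \<P>(\<omega> in M. y (n + 1) \<omega> = z \<bar> \<forall>k\<in>{1..n}. F k \<omega> = A k) = ballistic_measure \<mu> v (outer_boundary (A n)) z"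
    unfolding incremental_aggregation_def by blast
  \<comment> \<open>\<open>ballistic_measure_eq_0\<close> supplies \<open>\<nu>_eq_0\<close>, and
    the choice of \<open>C\<close> supplies \<open>\<nu>_le\<close>.\<close>
  then interpret aggregation_process M "ballistic_measure \<mu> v" F y C
    using C by unfold_locales (auto simp: ballistic_measure_eq_0)
  show ?thesis by (rule AE_lower_fractal_dimension_ge_2)
qed

end
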